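(* Let $d\rho$ be a probability measure on $\mathbb{R}$ of bounded but infinite support, with orthonormal polynomials $p_n(x)$ and Jacobi parameters $\{a_n,b_n\}_{n=1}^\infty$. Let $n\ge 1$, and let $d\nu^{(n)}$ be the measure on $\mathbb{R}$ determined by $$\frac{1}{\pi}\int_{-\infty}^{\infty} m_n^{(b)}(z)\,\frac{db}{1+b^2}=\int \frac{d\nu^{(n)}(x)}{x-z}\qquad (\operatorname{Im} z>0),$$ where $m_n^{(b)}(z)=\langle \delta, (J_n^{(b)}-z)^{-1}\delta\rangle$ is the function defined in the context. Then $$d\nu^{(n)}(x)=\frac{dx}{\pi\,\bigl(a_n^2\,p_n^2(x)+p_{n-1}^2(x)\bigr)}.$$
   Context: The orthonormal polynomials $p_n$ of $d\rho$ ($\deg p_n=n$, positive leading coefficient, $p_0=1$, and by convention $p_{-1}=0$) obey the three-term recursion $xp_n(x)=a_{n+1}p_{n+1}(x)+b_{n+1}p_n(x)+a_np_{n-1}(x)$ for $n\ge 0$, with $b_n\in\mathbb{R}$ and $a_n\in(0,\infty)$; the numbers $\{a_n,b_n\}_{n=1}^\infty$ are called the Jacobi parameters of $d\rho$. The associated semi-infinite Jacobi matrix $J$ is the tridiagonal symmetric matrix with diagonal entries $b_1,b_2,b_3,\dots$ and off-diagonal entries $a_1,a_2,a_3,\dots$. For $n\ge1$, $J_{n;F}$ is the $n\times n$ matrix formed by the top $n$ rows and left $n$ columns of $J$ (so its diagonal is $b_1,\dots,b_n$ and its off-diagonal entries are $a_1,\dots,a_{n-1}$). For $b\in\mathbb{R}$,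 $J_n^{(b)}$ is the matrix $J_{n;F}$ with the entry $b_n$ replaced by $b_n+b$. The vector $\delta$ is the first standard basis vector of $\mathbb{C}^n$ (corresponding to the first row of $J$), and $m_n^{(b)}(z)=\langle\delta,(J_n^{(b)}-z)^{-1}\delta\rangle$ for $\operatorname{Im} z>0$. Thus $d\nu^{(n)}$ is the average, with respect to $\frac{1}{\pi}\frac{db}{1+b^2}$, of the spectral measures of $J_n^{(b)}$ for the vector $\delta$. *)

theory Defs
  imports
    "HOL-Probability.Probability"
    "HOL-Computational_Algebra.Polynomial"
    "Jordan_Normal_Form.Gauss_Jordan_Elimination"
begin

definition measure_support :: "'a::topological_space measure \<Rightarrow> 'a set" where
  "measure_support M = {x. \<forall>U. open U \<longrightarrow> x \<in> U \<longrightarrow> emeasure M U > 0}"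

definition orthonormal_polys :: "real measure \<Rightarrow> (nat \<Rightarrow> real poly) \<Rightarrow> bool" where
  "orthonormal_polys \<rho> p \<longleftrightarrow>
     (\<forall>n. degree (p n) = n \<and> lead_coeff (p n) > 0) \<and>
     (\<forall>m n. (\<integral>x. poly (p m) x * poly (p n) x \<partial>\<rho>) = (if m = n then 1 else 0))"

text \<open>
  The parameters are indexed from 1, as in the literature; the values at index 0 are
  irrelevant. The conditional renders the convention that the polynomial of index
  minus one is zero.
\<close>

definition jacobi_parameters ::
    "(nat \<Rightarrow> real poly) \<Rightarrow> (nat \<Rightarrow> real) \<Rightarrow> (nat \<Rightarrow> real) \<Rightarrow> bool" where
  "jacobi_parameters p a b \<longleftrightarrow>
     (\<forall>n\<ge>1. a n > 0) \<and>
     (\<forall>n x. x * poly (p n) x =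
        a (n + 1) * poly (p (n + 1)) x + b (n + 1) * poly (p n) x
        + (if n = 0 then 0 else a n * poly (p (n - 1)) x))"

text \<open>Rows and columns are numbered from 0, so that the diagonal entry in row \<open>i\<close> is \<open>b (i + 1)\<close>.\<close>

definition jacobi_entry :: "(nat \<Rightarrow> real) \<Rightarrow> (nat \<Rightarrow> real) \<Rightarrow> nat \<Rightarrow> nat \<Rightarrow> real" where
  "jacobi_entry a b i j =
     (if i = j then b (i + 1)
      else if j = i + 1 then a (i + 1)
      else if i = j + 1 then a (j + 1)
      else 0)"

definition jacobi_trunc :: "(nat \<Rightarrow> real) \<Rightarrow> (nat \<Rightarrow> real) \<Rightarrow> nat \<Rightarrow> complex mat" where
  "jacobi_trunc a b n = mat n n (\<lambda>(i, j). complex_of_real (jacobi_entry a b i j))"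

definition jacobi_perturbed ::
    "(nat \<Rightarrow> real) \<Rightarrow> (nat \<Rightarrow> real) \<Rightarrow> nat \<Rightarrow> real \<Rightarrow> complex mat" where
  "jacobi_perturbed a b n \<beta> =
     mat n n (\<lambda>(i, j). if i = n - 1 \<and> j = n - 1
                       then jacobi_trunc a b n $$ (i, j) + complex_of_real \<beta>
                       else jacobi_trunc a b n $$ (i, j))"

text \<open>
  The inner product is antilinear in its first argument, whereas \<open>\<bullet>c\<close> conjugates its
  second argument; hence the order of the factors. The matrix to be inverted is invertible
  for \<open>Im z > 0\<close>, being a real symmetric matrix minus \<open>z\<close>.
\<close>

definition m_function ::
    "(nat \<Rightarrow> real) \<Rightarrow> (nat \<Rightarrow> real) \<Rightarrow> nat \<Rightarrow> real \<Rightarrow> complex \<Rightarrow> complex" where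
  "m_function a b n \<beta> z =
     (the (mat_inverse (jacobi_perturbed a b n \<beta> - z \<cdot>\<^sub>m 1\<^sub>m n)) *\<^sub>v unit_vec n 0)
       \<bullet>c unit_vec n 0"

text \<open>
  No finiteness is imposed on \<open>\<nu>\<close>; only that its Stieltjes transform exists.
\<close>

definition averaged_spectral_measure ::
    "(nat \<Rightarrow> real) \<Rightarrow> (nat \<Rightarrow> real) \<Rightarrow> nat \<Rightarrow> real measure \<Rightarrow> bool" where
  "averaged_spectral_measure a b n \<nu> \<longleftrightarrow>
     sets \<nu> = sets borel \<and>
     (\<forall>z. Im z > 0 \<longrightarrow>
        integrable \<nu> (\<lambda>x. 1 / (complex_of_real x - z)) \<and>
        complex_of_real (1 / pi) *
            (\<integral>\<beta>. m_function a b n \<beta> z / complex_of_real (1 + \<beta>\<^sup>2) \<partial>lborel)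
          = (\<integral>x. 1 / (complex_of_real x - z) \<partial>\<nu>))"

end

theory Submission
  imports Defs "HOL-Complex_Analysis.Complex_Analysis" "Jordan_Normal_Form.Determinant"
begin

text \<open>
  Write \<open>P\<^sub>k\<close>, \<open>Q\<^sub>k\<close> for the polynomials of the first and second kind of the Jacobi parameters,
  and \<open>n = m + 1\<close>. Solving the tridiagonal system \<open>(J - z) x = \<delta>\<close> for the matrix with last
  diagonal entry shifted by \<open>\<beta>\<close> gives \<open>x\<^sub>k = Q\<^sub>k + M P\<^sub>k\<close>, where the last row forces
  \<open>M = (a\<^sub>n Q\<^sub>n - \<beta> Q\<^sub>m) / (\<beta> P\<^sub>m - a\<^sub>n P\<^sub>n)\<close>, and then the \<open>m\<close>-function is \<open>x\<^sub>0 = M\<close>.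

  As a function of \<open>\<beta>\<close> this is a Moebius transformation. For \<open>Im z > 0\<close> its pole lies in the upper
  half plane, so it is bounded and holomorphic in the lower one, and averaging it against the
  Cauchy weight, which is the Poisson kernel of the point \<open>-\<i>\<close>, evaluates it at \<open>\<beta> = -\<i>\<close>. The
  averaged \<open>m\<close>-function is therefore the single rational function
  \<open>F(z) = - (a\<^sub>n Q\<^sub>n + \<i> Q\<^sub>m) / (a\<^sub>n P\<^sub>n + \<i> P\<^sub>m)\<close>. It has no pole in the closed upper half plane and
  decays like \<open>1/z\<close>, so Cauchy's theorem recovers it as the Stieltjes transform of its boundary
  density \<open>Im F(x) / \<pi>\<close>. On the real line the Wronskian \<open>a\<^sub>n (Q\<^sub>n P\<^sub>m - Q\<^sub>m P\<^sub>n)\<close> is \<open>1\<close>, whence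
  \<open>Im F = 1 / (a\<^sub>n\<^sup>2 P\<^sub>n\<^sup>2 + P\<^sub>m\<^sup>2)\<close>.

  This shows that the measure with the stated density has the required transform
  (\<open>integral_transfer_fraction_cauchy_weight\<close>, \<open>transfer_fraction_stieltjes_representation\<close>).
  That no other measure has it is the injectivity of the Stieltjes transform
  (\<open>stieltjes_transform_unique\<close>); it is proved for measures that are not assumed finite, by the
  Stieltjes inversion formula for compact intervals.
\<close>

section \<open>Integrals along the boundary of the upper half plane\<close>

text \<open>
  Quadratic decay in the closed upper half plane is obtained below by bounding the product with
  \<open>(z + \<i>)\<^sup>2\<close>, which is continuous and, unlike \<open>1 + z\<^sup>2\<close>, has no zero there.
\<close>

lemma norm_plus_i_ge:
  assumes "Im z \<ge> 0" shows "1 + (norm z)\<^sup>2 \<le> (norm (z + \<i>))\<^sup>2"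
  using assms unfolding cmod_power2 by (simp add: power2_eq_square algebra_simps)

lemma bounded_on_closed_if_limit_at_infinity:
  fixes f :: "complex \<Rightarrow> complex"
  assumes "closed S" "continuous_on S f" "(f \<longlongrightarrow> l) at_infinity"
  obtains C where "C > 0" "\<And>z. z \<in> S \<Longrightarrow> norm (f z) \<le> C"
proof -
  have "eventually (\<lambda>z. dist (f z) l < 1) at_infinity"
    using assms(3) by (rule tendstoD) simp
  then obtain R where R: "\<And>z. norm z \<ge> R \<Longrightarrow> dist (f z) l < 1"
    unfolding eventually_at_infinity by blast
  have "compact (S \<inter> cball 0 R)" using assms(1) by (simp add: closed_Int_compact)
  moreover have "continuous_on (S \<inter> cball 0 R) f"
    using assms(2) continuous_on_subset by blast
  ultimately have "bounded (f ` (S \<inter> cball 0 R))"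
    by (simp add: compact_continuous_image compact_imp_bounded)
  then obtain B where B: "\<And>z. z \<in> S \<inter> cball 0 R \<Longrightarrow> norm (f z) \<le> B"
    unfolding bounded_iff by blast
  have "norm (f z) \<le> max 1 (max B (norm l + 1))" if "z \<in> S" for z
  proof (cases "norm z \<ge> R")
    case True
    have "norm (f z) \<le> norm l + dist (f z) l"
      by (metis add.commute dist_norm norm_triangle_sub)
    with R[OF True] show ?thesis by linarith
  next
    case False
    then show ?thesis using B[of z] that by auto
  qed
  then show ?thesis using that[of "max 1 (max B (norm l + 1))"] by auto
qed

lemma integrable_if_le_inverse_1_plus_square:
  fixes f :: "real \<Rightarrow> complex"
  assumes [measurable]: "f \<in> borel_measurable borel" and "\<And>x. norm (f x) \<le> C / (1 + x\<^sup>2)"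
  shows "integrable lborel f"
proof (rule Bochner_Integration.integrable_bound)
  have "integrable lborel (\<lambda>x::real. C * inverse (1 + x\<^sup>2))"
    using integrable_inverse_1_plus_square
    by (simp add: set_integrable_def einterval_eq)
  then show "integrable lborel (\<lambda>x::real. C / (1 + x\<^sup>2))"
    by (simp add: divide_inverse)
  show "f \<in> borel_measurable lborel" by simp
  show "AE x in lborel. norm (f x) \<le> norm (C / (1 + x\<^sup>2))"
    using assms(2) by (intro AE_I2) (metis abs_ge_self order_trans real_norm_def)
qed

lemma continuous_on_real_line:
  assumes "continuous_on {z. Im z \<ge> 0} f"
  shows "continuous_on UNIV (\<lambda>x. f (complex_of_real x))"
  by (rule continuous_on_compose2[OF assms]) (auto intro!: continuous_intros)

lemma convex_upper_half_plane: "convex {z. Im z \<ge> 0}"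
  using convex_halfspace_Im_ge[of 0] by simp

lemma closed_upper_half_plane: "closed {z. Im z \<ge> 0}"
  using closed_halfspace_Im_ge[of 0] by simp

lemma interior_upper_half_plane: "interior {z. Im z \<ge> 0} \<subseteq> {z. Im z > 0}"
proof
  fix z assume "z \<in> interior {z. Im z \<ge> 0}"
  then obtain e where e: "e > 0" "ball z e \<subseteq> {z. Im z \<ge> 0}" by (meson mem_interior)
  have "z - \<i> * of_real (e/2) \<in> ball z e" using e(1) by (simp add: dist_norm norm_mult)
  with e have "Im (z - \<i> * of_real (e/2)) \<ge> 0" by blast
  with e(1) show "z \<in> {z. Im z > 0}" by simp
qed

text \<open>
  Cauchy's theorem for half discs of radius \<open>R\<close>: the arc has length \<open>\<pi> R\<close> and carries values of
  size \<open>1 / R\<^sup>2\<close>, so its contribution vanishes in the limit.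
\<close>

lemma integral_real_line_eq_0:
  fixes f :: "complex \<Rightarrow> complex"
  assumes cont: "continuous_on {z. Im z \<ge> 0} f" and holo: "f holomorphic_on {z. Im z > 0}"
    and bound: "\<And>z. Im z \<ge> 0 \<Longrightarrow> norm (f z) \<le> C / (1 + (norm z)\<^sup>2)"
  shows "integrable lborel (\<lambda>x. f (complex_of_real x))"
    and "(\<integral>x. f (complex_of_real x) \<partial>lborel) = 0"
proof -
  let ?g = "\<lambda>x. f (complex_of_real x)"
  have C: "C \<ge> 0" using order_trans[OF norm_ge_zero bound[of 0]] by simp
  have contg: "continuous_on UNIV ?g" by (rule continuous_on_real_line[OF cont])
  show int: "integrable lborel ?g"
  proof (rule integrable_if_le_inverse_1_plus_square[where C = C])
    show "?g \<in> borel_measurable borel"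
      using contg by (rule borel_measurable_continuous_onI)
    show "norm (?g x) \<le> C / (1 + x\<^sup>2)" for x
      using bound[of "complex_of_real x"] by simp
  qed
  have arc: "norm (integral {-R..R} ?g) \<le> C * pi / R" if R: "R > 0" for R :: real
  proof -
    let ?l = "linepath (complex_of_real (-R)) (complex_of_real R)"
    let ?c = "part_circlepath 0 R 0 pi"
    have img: "path_image (?l +++ ?c) \<subseteq> {z. Im z \<ge> 0}"
    proof (rule subset_path_image_join)
      show "path_image ?l \<subseteq> {z. Im z \<ge> 0}"
        unfolding path_image_linepath
        by (rule closed_segment_subset[OF _ _ convex_upper_half_plane]) auto
      show "path_image ?c \<subseteq> {z. Im z \<ge> 0}"
        using R by (auto simp: path_image_part_circlepath Im_exp intro!: mult_nonneg_nonneg sin_ge_zero)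
    qed
    have ends: "pathfinish ?l = pathstart ?c" "pathfinish ?c = pathstart ?l"
      by (simp_all add: exp_eq_polar cis.ctr complex_eq_iff)
    have "(f has_contour_integral 0) (?l +++ ?c)"
    proof (rule Cauchy_theorem_convex[OF cont convex_upper_half_plane finite.emptyI _ _ img])
      show "f field_differentiable at x" if "x \<in> interior {z. Im z \<ge> 0} - {}" for x
        using that interior_upper_half_plane holo open_halfspace_Im_gt[of 0]
        by (auto intro: holomorphic_on_imp_differentiable_at)
      show "valid_path (?l +++ ?c)"
        using ends by (intro valid_path_join) simp_all
      show "pathfinish (?l +++ ?c) = pathstart (?l +++ ?c)"
        using ends by simp
    qed
    then have "contour_integral (?l +++ ?c) f = 0" by (rule contour_integral_unique)
    moreover have img': "path_image ?l \<subseteq> {z. Im z \<ge> 0}" "path_image ?c \<subseteq> {z. Im z \<ge> 0}"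
      using img ends(1) by (simp_all add: path_image_join)
    have ii: "f contour_integrable_on ?l"
      using img'(1) unfolding path_image_linepath
      by (intro contour_integrable_continuous_linepath continuous_on_subset[OF cont])
    have ii': "f contour_integrable_on ?c"
      using img'(2)
      by (intro contour_integrable_continuous_part_circlepath continuous_on_subset[OF cont])
    have "contour_integral (?l +++ ?c) f = contour_integral ?l f + contour_integral ?c f"
      by (rule contour_integral_join[OF ii ii']) simp_all
    ultimately have eq: "contour_integral ?l f + contour_integral ?c f = 0" by simp
    have "norm (contour_integral ?c f) \<le> (C / (1 + R\<^sup>2)) * R * (pi - 0)"
    proof (rule has_contour_integral_bound_part_circlepath[OF has_contour_integral_integral[OF ii']])
      fix x assume x: "x \<in> path_image ?c"
      then have "norm x = R"
        using R by (auto simp: path_image_part_circlepath norm_mult)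
      then show "norm (f x) \<le> C / (1 + R\<^sup>2)"
        using bound[of x] x img'(2) by auto
    qed (use R C in auto)
    also have "\<dots> = C * pi * (R / (1 + R\<^sup>2))" by simp
    also have "\<dots> \<le> C * pi * (R / R\<^sup>2)"
      using R C by (intro mult_left_mono divide_left_mono) (auto intro!: mult_pos_pos add_pos_nonneg)
    also have "\<dots> = C * pi / R" using R by (simp add: power2_eq_square)
    finally have "norm (contour_integral ?c f) \<le> C * pi / R" .
    moreover have "contour_integral ?l f = - contour_integral ?c f"
      using eq by (simp add: eq_neg_iff_add_eq_0)
    ultimately have "norm (contour_integral ?l f) \<le> C * pi / R" by simp
    moreover have "contour_integral ?l f = integral {-R..R} ?g"
      using R by (subst contour_integral_linepath_Reals_eq) auto
    ultimately show ?thesis by simp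
  qed
  have lim: "(\<lambda>k::nat. \<integral>x. indicator {-(real (Suc k))..real (Suc k)} x *\<^sub>R ?g x \<partial>lborel) \<longlonglongrightarrow> (\<integral>x. ?g x \<partial>lborel)"
  proof (rule integral_dominated_convergence[where w = "\<lambda>x. norm (?g x)"])
    show "AE x in lborel. (\<lambda>k::nat. indicator {-(real (Suc k))..real (Suc k)} x *\<^sub>R ?g x) \<longlonglongrightarrow> ?g x"
    proof (rule AE_I2, rule tendsto_eventually)
      fix x :: real
      obtain N :: nat where N: "\<bar>x\<bar> \<le> real N" using real_arch_simple by blast
      show "\<forall>\<^sub>F k in sequentially. indicator {-(real (Suc k))..real (Suc k)} x *\<^sub>R ?g x = ?g x"
        using eventually_ge_at_top[of N] by eventually_elim (use N in \<open>auto simp: indicator_def\<close>)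
    qed
  qed (use int in \<open>auto simp: indicator_def\<close>)
  have bd: "norm (\<integral>x. indicator {-(real (Suc k))..real (Suc k)} x *\<^sub>R ?g x \<partial>lborel) \<le> C * pi / real (Suc k)" for k
  proof -
    have "set_integrable lborel {-(real (Suc k))..real (Suc k)} ?g"
      unfolding set_integrable_def using int by (intro integrable_mult_indicator) simp_all
    then have "(LINT x:{-(real (Suc k))..real (Suc k)}|lborel. ?g x) = integral {-(real (Suc k))..real (Suc k)} ?g"
      by (rule set_borel_integral_eq_integral)
    moreover have "norm (integral {-(real (Suc k))..real (Suc k)} ?g) \<le> C * pi / real (Suc k)"
      by (rule arc) simp
    ultimately show ?thesis unfolding set_lebesgue_integral_def by metis
  qed
  have "(\<lambda>k::nat. \<integral>x. indicator {-(real (Suc k))..real (Suc k)} x *\<^sub>R ?g x \<partial>lborel) \<longlonglongrightarrow> 0"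
  proof (rule Lim_null_comparison)
    show "(\<lambda>k. C * pi / real (Suc k)) \<longlonglongrightarrow> 0"
      by (rule LIMSEQ_Suc[OF lim_const_over_n])
  qed (rule always_eventually, rule allI, rule bd)
  with lim show "(\<integral>x. ?g x \<partial>lborel) = 0" by (rule LIMSEQ_unique)
qed

lemma has_integral_inverse_1_plus_square:
  "has_bochner_integral lborel (\<lambda>x::real. inverse (1 + x\<^sup>2)) pi"
  using integrable_inverse_1_plus_square LBINT_inverse_1_plus_square
  by (simp add: has_bochner_integral_iff set_integrable_def einterval_eq
      interval_lebesgue_integral_def set_lebesgue_integral_def)

lemma mult_cnj_diff_of_real:
  "(complex_of_real x - w) * (complex_of_real x - cnj w) = of_real ((x - Re w)\<^sup>2 + (Im w)\<^sup>2)"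
  by (simp add: complex_eq_iff power2_eq_square algebra_simps)

lemma has_integral_cauchy_kernel:
  assumes "Im w > 0"
  shows "has_bochner_integral lborel
           (\<lambda>x. 1 / ((complex_of_real x - w) * (complex_of_real x - cnj w))) (of_real (pi / Im w))"
proof -
  let ?y = "Im w"
  \<comment> \<open>the substitution \<open>t = (x - Re w) / Im w\<close> in the integral of \<open>1 / (1 + t\<^sup>2)\<close>\<close>
  have "has_bochner_integral lborel (\<lambda>x::real. inverse (1 + (- Re w / ?y + (1 / ?y) * x)\<^sup>2)) (pi /\<^sub>R \<bar>1 / ?y\<bar>)"
    using assms has_integral_inverse_1_plus_square
    by (subst lborel_has_bochner_integral_real_affine_iff[symmetric]) auto
  then have "has_bochner_integral lborel (\<lambda>x::real. (1 / ?y\<^sup>2) * inverse (1 + (- Re w / ?y + (1 / ?y) * x)\<^sup>2)) ((1 / ?y\<^sup>2) * (pi /\<^sub>R \<bar>1 / ?y\<bar>))"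
    by (intro has_bochner_integral_mult_right) simp
  also have "(\<lambda>x::real. (1 / ?y\<^sup>2) * inverse (1 + (- Re w / ?y + (1 / ?y) * x)\<^sup>2)) = (\<lambda>x. 1 / ((x - Re w)\<^sup>2 + ?y\<^sup>2))"
  proof
    fix x :: real
    have "- Re w / ?y + (1 / ?y) * x = (x - Re w) / ?y" by (simp add: diff_divide_distrib)
    then have "?y\<^sup>2 * (1 + (- Re w / ?y + (1 / ?y) * x)\<^sup>2) = (x - Re w)\<^sup>2 + ?y\<^sup>2"
      using assms by (simp add: power_divide distrib_left)
    then show "(1 / ?y\<^sup>2) * inverse (1 + (- Re w / ?y + (1 / ?y) * x)\<^sup>2) = 1 / ((x - Re w)\<^sup>2 + ?y\<^sup>2)"
      by (metis inverse_eq_divide inverse_mult_distrib)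
  qed
  also have "(1 / ?y\<^sup>2) * (pi /\<^sub>R \<bar>1 / ?y\<bar>) = pi / ?y"
    using assms by (simp add: power2_eq_square)
  finally have "has_bochner_integral lborel (\<lambda>x. complex_of_real (1 / ((x - Re w)\<^sup>2 + ?y\<^sup>2))) (of_real (pi / ?y))"
    by (rule has_bochner_integral_of_real)
  then show ?thesis unfolding mult_cnj_diff_of_real by (simp only: of_real_divide of_real_1)
qed

lemma tendsto_moebius_at_infinity: "((\<lambda>z. (z + \<i>) / (z - v)) \<longlongrightarrow> 1) at_infinity"
proof -
  have "((\<lambda>z. (1 + \<i> * inverse z) / (1 - v * inverse z)) \<longlongrightarrow> (1 + \<i> * 0) / (1 - v * 0)) at_infinity"
    by (intro tendsto_intros tendsto_inverse_0) auto
  moreover have "\<forall>\<^sub>F z in at_infinity. (1 + \<i> * inverse z) / (1 - v * inverse z) = (z + \<i>) / (z - v)"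
    using eventually_not_equal_at_infinity[of 0]
  proof eventually_elim
    case (elim z)
    then have "1 + \<i> * inverse z = (z + \<i>) / z" "1 - v * inverse z = (z - v) / z"
      by (simp_all add: divide_simps)
    then show ?case using elim by simp
  qed
  ultimately show ?thesis by (simp add: tendsto_cong)
qed

text \<open>
  Subtracting from \<open>G\<close> its value at \<open>w\<close> cancels the only pole of the integrand in the upper half
  plane. What is left is continuous up to the boundary and of quadratic decay, so that its integral
  vanishes; the subtracted constant contributes the integral of the Cauchy kernel.
\<close>

lemma poisson_formula:
  assumes cont: "continuous_on {z. Im z \<ge> 0} G" and holo: "G holomorphic_on {z. Im z > 0}"
    and bound: "\<And>z. Im z \<ge> 0 \<Longrightarrow> norm (G z) \<le> C" and w: "Im w > 0"
  shows "has_bochner_integral lborel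
           (\<lambda>x. G (of_real x) / ((of_real x - w) * (of_real x - cnj w))) (of_real (pi / Im w) * G w)"
proof -
  let ?S = "{z. Im z \<ge> 0}" and ?U = "{z. Im z > 0}"
  have U: "open ?U" using open_halfspace_Im_gt[of 0] by simp
  have nw: "z \<noteq> cnj w" if "Im z \<ge> 0" for z using that w by auto
  define k where "k = (\<lambda>z. if z = w then deriv G w else (G z - G w) / (z - w))"
  have holok: "k holomorphic_on ?U"
    unfolding k_def using holo w U by (intro pole_lemma) (simp_all add: interior_open)
  have contk: "continuous_on ?S k"
    unfolding continuous_on_eq_continuous_within
  proof
    fix z assume z: "z \<in> ?S"
    show "continuous (at z within ?S) k"
    proof (cases "z = w")
      case True
      have "isCont k w"
        using holomorphic_on_imp_continuous_on[OF holok] w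
        unfolding continuous_on_eq_continuous_at[OF U] by blast
      then show ?thesis unfolding True by (rule continuous_at_imp_continuous_at_within)
    next
      case False
      have "continuous (at z within ?S) G"
        using cont z unfolding continuous_on_eq_continuous_within by blast
      then have "continuous (at z within ?S) (\<lambda>z. (G z - G w) / (z - w))"
        using False by (intro continuous_intros) simp_all
      then show ?thesis
        by (rule continuous_transform_within[where \<delta> = "dist z w"])
           (use False z in \<open>auto simp: k_def dist_commute\<close>)
    qed
  qed
  define h where "h = (\<lambda>z. k z / (z - cnj w))"
  define r where "r = (\<lambda>z. (z + \<i>)\<^sup>2 / ((z - w) * (z - cnj w)))"
  have conth: "continuous_on ?S h" unfolding h_def using contk nw by (intro continuous_intros) auto
  have "(r \<longlongrightarrow> 1) at_infinity"
    using tendsto_mult[OF tendsto_moebius_at_infinity[of w] tendsto_moebius_at_infinity[of "cnj w"]]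
    unfolding r_def by (simp add: power2_eq_square)
  then have "\<forall>\<^sub>F z in at_infinity. dist (r z) 1 < 1"
    by (rule tendstoD) simp
  then obtain R where R: "\<And>z. norm z \<ge> R \<Longrightarrow> dist (r z) 1 < 1"
    unfolding eventually_at_infinity by blast
  define K where "K = ?S \<inter> cball 0 (max R (norm w))"
  have "compact K"
    using closed_upper_half_plane unfolding K_def by (simp add: closed_Int_compact)
  moreover have "continuous_on K (\<lambda>z. (z + \<i>)\<^sup>2 * h z)"
    unfolding K_def by (intro continuous_intros continuous_on_subset[OF conth]) auto
  ultimately have "bounded ((\<lambda>z. (z + \<i>)\<^sup>2 * h z) ` K)"
    by (intro compact_imp_bounded compact_continuous_image)
  then obtain B where B: "\<And>z. z \<in> K \<Longrightarrow> norm ((z + \<i>)\<^sup>2 * h z) \<le> B"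
    unfolding bounded_iff by blast
  \<comment> \<open>on the compact part \<open>h\<close> is bounded by continuity; outside it \<open>w\<close> is excluded, so that \<open>h\<close> is the
    plain quotient and the limit of \<open>r\<close> applies\<close>
  have bound_h: "norm ((z + \<i>)\<^sup>2 * h z) \<le> max B (4 * C)" if z: "Im z \<ge> 0" for z
  proof (cases "norm z \<le> max R (norm w)")
    case True
    then have "z \<in> K" using z by (simp add: K_def)
    then show ?thesis using B[of z] by linarith
  next
    case False
    have "norm (r z) \<le> 1 + dist (r z) 1"
      by (metis dist_norm norm_one norm_triangle_sub)
    moreover have "dist (r z) 1 < 1"
      by (rule R) (use False in linarith)
    ultimately have "norm (r z) \<le> 2" by linarith
    moreover have "norm (G z - G w) \<le> 2 * C"
      using norm_triangle_ineq4[of "G z" "G w"] bound[of z] bound[of w] z w by linarith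
    ultimately have "norm (r z * (G z - G w)) \<le> 2 * (2 * C)"
      unfolding norm_mult by (rule mult_mono) simp_all
    moreover have "(z + \<i>)\<^sup>2 * h z = r z * (G z - G w)"
      using False by (auto simp: h_def k_def r_def)
    ultimately show ?thesis by simp
  qed
  have "norm (h z) \<le> max B (4 * C) / (1 + (norm z)\<^sup>2)" if z: "Im z \<ge> 0" for z
  proof -
    have "(1 + (norm z)\<^sup>2) * norm (h z) \<le> (norm (z + \<i>))\<^sup>2 * norm (h z)"
      using norm_plus_i_ge[OF z] by (rule mult_right_mono) simp
    also have "\<dots> = norm ((z + \<i>)\<^sup>2 * h z)" by (simp add: norm_mult norm_power)
    also have "\<dots> \<le> max B (4 * C)" by (rule bound_h[OF z])
    finally show ?thesis by (simp add: pos_le_divide_eq add_pos_nonneg mult.commute)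
  qed
  moreover have "h holomorphic_on ?U" unfolding h_def using holok nw by (intro holomorphic_intros) auto
  ultimately have "has_bochner_integral lborel (\<lambda>x. h (of_real x)) 0"
    unfolding has_bochner_integral_iff using integral_real_line_eq_0[OF conth] by blast
  then have "has_bochner_integral lborel
      (\<lambda>x. h (of_real x) + G w * (1 / ((complex_of_real x - w) * (complex_of_real x - cnj w)))) (0 + G w * (of_real (pi / Im w)))"
    using has_integral_cauchy_kernel[OF w]
    by (intro has_bochner_integral_add has_bochner_integral_mult_right) auto
  moreover have "h (of_real x) + G w * (1 / ((complex_of_real x - w) * (complex_of_real x - cnj w)))
      = G (of_real x) / ((of_real x - w) * (of_real x - cnj w))" for x
  proof -
    have "complex_of_real x \<noteq> w" using w by auto
    then show ?thesis by (simp add: h_def k_def flip: add_divide_distrib)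
  qed
  ultimately show ?thesis by (simp only: add_0_left mult.commute[of "G w"])
qed

text \<open>
  A function that decays like \<open>1/z\<close> is the Stieltjes transform of its boundary imaginary part. Write
  \<open>2 \<i> Im F = F - cnj F\<close>. Since \<open>1 / (x - w)\<close> and \<open>1 / (x - cnj w)\<close> differ by a multiple of the Poisson
  kernel, the Poisson formula turns the integral of \<open>F / (x - w)\<close> into that of \<open>F / (x - cnj w)\<close>,
  which is zero because that quotient is holomorphic in the upper half plane; conjugating the latter
  integral shows that \<open>cnj F / (x - w)\<close> also contributes nothing.
\<close>

lemma stieltjes_representation:
  assumes cont: "continuous_on {z. Im z \<ge> 0} F" and holo: "F holomorphic_on {z. Im z > 0}"
    and bound: "\<And>z. Im z \<ge> 0 \<Longrightarrow> norm (F z) * norm (z + \<i>) \<le> C" and w: "Im w > 0"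
  shows "has_bochner_integral lborel
           (\<lambda>x. of_real (Im (F (of_real x))) / (of_real x - w)) (of_real pi * F w)"
proof -
  let ?S = "{z. Im z \<ge> 0}"
  have ni: "norm (z + \<i>) \<ge> 1" if "Im z \<ge> 0" for z
    using that abs_Im_le_cmod[of "z + \<i>"] by simp
  have bF: "norm (F z) \<le> C" if "Im z \<ge> 0" for z
    using mult_left_mono[OF ni[OF that] norm_ge_zero[of "F z"]] bound[OF that] by linarith
  have nw: "z - cnj w \<noteq> 0" if "Im z \<ge> 0" for z using that w by (auto simp: complex_eq_iff)
  let ?h = "\<lambda>z. F z / (z - cnj w)"
  have conth: "continuous_on ?S ?h"
    using cont nw by (intro continuous_intros) auto
  have "?h holomorphic_on {z. Im z > 0}"
    using holo nw by (intro holomorphic_intros) auto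
  moreover obtain B where B: "B > 0" "\<And>z. Im z \<ge> 0 \<Longrightarrow> norm ((z + \<i>) / (z - cnj w)) \<le> B"
  proof -
    have "continuous_on ?S (\<lambda>z. (z + \<i>) / (z - cnj w))"
      using nw by (intro continuous_intros) auto
    from bounded_on_closed_if_limit_at_infinity[OF closed_upper_half_plane this tendsto_moebius_at_infinity]
    show ?thesis using that by (metis mem_Collect_eq)
  qed
  have "norm (?h z) \<le> (C * B) / (1 + (norm z)\<^sup>2)" if z: "Im z \<ge> 0" for z
  proof -
    have "(1 + (norm z)\<^sup>2) * norm (?h z) \<le> (norm (z + \<i>))\<^sup>2 * norm (?h z)"
      using norm_plus_i_ge[OF z] by (rule mult_right_mono) simp
    also have "\<dots> = (norm (F z) * norm (z + \<i>)) * norm ((z + \<i>) / (z - cnj w))"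
      by (simp add: norm_mult norm_divide power2_eq_square)
    also have "\<dots> \<le> C * B"
      by (rule mult_mono[OF bound[OF z] B(2)[OF z] order_trans[OF norm_ge_zero bF[OF z]] norm_ge_zero])
    finally show ?thesis by (simp add: pos_le_divide_eq add_pos_nonneg mult.commute)
  qed
  ultimately have 0: "has_bochner_integral lborel (\<lambda>x. ?h (of_real x)) 0"
    unfolding has_bochner_integral_iff
    by (intro conjI integral_real_line_eq_0[of ?h "C * B", OF conth])
  have 1: "has_bochner_integral lborel (\<lambda>x. cnj (?h (of_real x))) (cnj 0)"
    by (rule has_bochner_integral_bounded_linear[OF bounded_linear_cnj 0])
  have 2: "has_bochner_integral lborel
      (\<lambda>x. 2 * \<i> * of_real (Im w) * (F (of_real x) / ((of_real x - w) * (of_real x - cnj w)))) (2 * \<i> * of_real (Im w) * (of_real (pi / Im w) * F w))"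
    by (rule has_bochner_integral_mult_right) (rule poisson_formula[OF cont holo bF w])
  have "has_bochner_integral lborel
      (\<lambda>x. (1 / (2 * \<i>)) * ((2 * \<i> * of_real (Im w) * (F (of_real x) / ((of_real x - w) * (of_real x - cnj w))) + ?h (of_real x)) - cnj (?h (of_real x))))
      ((1 / (2 * \<i>)) * ((2 * \<i> * of_real (Im w) * (of_real (pi / Im w) * F w) + 0) - cnj 0))"
    by (rule has_bochner_integral_mult_right)
       (rule has_bochner_integral_diff[OF has_bochner_integral_add[OF 2 0] 1])
  moreover have "(1 / (2 * \<i>)) * ((2 * \<i> * of_real (Im w) * (F (of_real x) / ((of_real x - w) * (of_real x - cnj w))) + ?h (of_real x)) - cnj (?h (of_real x)))
     = of_real (Im (F (of_real x))) / (of_real x - w)" for x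
  proof -
    let ?x = "complex_of_real x" and ?f = "F (of_real x)"
    have ne: "?x - w \<noteq> 0" "?x - cnj w \<noteq> 0" using w by (auto simp: complex_eq_iff)
    have "A * f / (B * C) + f / C = f / B" if "C = A + B" "B \<noteq> 0" "C \<noteq> 0" for A B C f :: complex
      using that by (simp add: divide_simps) (simp add: algebra_simps)
    from this[OF _ ne, of "2 * \<i> * of_real (Im w)" ?f]
    have "2 * \<i> * of_real (Im w) * (?f / ((?x - w) * (?x - cnj w))) + ?h ?x = ?f / (?x - w)"
      by (simp add: complex_eq_iff)
    moreover have "cnj (?h ?x) = cnj ?f / (?x - w)" by simp
    ultimately have "(2 * \<i> * of_real (Im w) * (?f / ((?x - w) * (?x - cnj w))) + ?h ?x) - cnj (?h ?x) = (?f - cnj ?f) / (?x - w)"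
      by (simp only: diff_divide_distrib)
    moreover have "?f - cnj ?f = 2 * \<i> * of_real (Im ?f)" by (simp add: complex_eq_iff)
    ultimately show ?thesis by simp
  qed
  moreover have "(1 / (2 * \<i>)) * ((2 * \<i> * of_real (Im w) * (of_real (pi / Im w) * F w) + 0) - cnj 0) = of_real pi * F w"
    using w by simp
  ultimately show ?thesis by (simp only:)
qed

section \<open>Injectivity of the Stieltjes transform\<close>

definition poisson_kernel :: "complex \<Rightarrow> real \<Rightarrow> real" where
  "poisson_kernel z x = Im z / ((x - Re z)\<^sup>2 + (Im z)\<^sup>2)"

lemma Im_stieltjes_kernel: "Im (1 / (complex_of_real x - z)) = poisson_kernel z x"
  by (simp add: poisson_kernel_def Im_divide power2_eq_square)

lemma poisson_kernel_nonneg: "Im z > 0 \<Longrightarrow> poisson_kernel z x \<ge> 0"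
  by (simp add: poisson_kernel_def)

lemma DERIV_arctan_poisson_kernel:
  assumes "y > 0"
  shows "((\<lambda>u. arctan ((u - x) / y)) has_real_derivative poisson_kernel (Complex u y) x) (at u)"
proof -
  have "((\<lambda>u. arctan ((u - x) / y)) has_real_derivative (inverse (1 + ((u - x) / y)\<^sup>2) * (1 / y))) (at u)"
    using assms by (auto intro!: derivative_eq_intros)
  moreover have "inverse (1 + ((u - x) / y)\<^sup>2) * (1 / y) = y / ((x - u)\<^sup>2 + y\<^sup>2)"
  proof -
    have "1 + ((u - x) / y)\<^sup>2 = ((x - u)\<^sup>2 + y\<^sup>2) / y\<^sup>2"
      using assms by (simp add: power_divide add_divide_distrib power2_commute)
    then show ?thesis using assms by (simp add: power2_eq_square)
  qed
  ultimately show ?thesis by (simp add: poisson_kernel_def)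
qed

lemma nn_integral_poisson_kernel_Icc:
  assumes "y > 0" "c \<le> d"
  shows "(\<integral>\<^sup>+u. ennreal (poisson_kernel (Complex u y) x) * indicator {c..d} u \<partial>lborel)
    = ennreal (arctan ((d - x) / y) - arctan ((c - x) / y))"
  by (rule nn_integral_FTC_Icc)
     (use assms in \<open>simp_all add: DERIV_arctan_poisson_kernel poisson_kernel_nonneg,
      simp_all add: poisson_kernel_def\<close>)

text \<open>
  A majorant, uniform in \<open>y\<close> and in the interval, for the dominated convergence below. The function
  \<open>1 / (1 + x\<^sup>2)\<close> is the right scale: it is the Poisson kernel of \<open>\<i>\<close> and hence integrable for every
  measure that has a Stieltjes transform. Near the interval the trivial bound \<open>\<pi>\<close> suffices; far from
  it the mean value theorem produces a value of the Poisson kernel, of order \<open>1 / x\<^sup>2\<close>.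
\<close>

lemma arctan_diff_le:
  assumes y: "0 < y" "y \<le> 1" and cd: "c < d" "\<bar>c\<bar> \<le> L" "\<bar>d\<bar> \<le> L" and L: "L \<ge> 1"
  shows "arctan ((d - x) / y) - arctan ((c - x) / y) \<le> (pi * (1 + 4 * L\<^sup>2) + 16 * L) * (1 / (1 + x\<^sup>2))"
proof (cases "\<bar>x\<bar> \<le> 2 * L")
  case True
  have pos: "0 < 1 + x\<^sup>2" by (simp add: add_pos_nonneg)
  have "arctan ((d - x) / y) - arctan ((c - x) / y) \<le> pi"
    using arctan_ubound[of "(d - x) / y"] arctan_lbound[of "(c - x) / y"] by simp
  also have "\<dots> = pi * (1 + x\<^sup>2) * (1 / (1 + x\<^sup>2))"
    using pos by simp
  also have "\<dots> \<le> (pi * (1 + 4 * L\<^sup>2) + 16 * L) * (1 / (1 + x\<^sup>2))"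
  proof (rule mult_right_mono)
    have "x\<^sup>2 \<le> (2 * L)\<^sup>2" using True by (rule abs_le_square_iff[THEN iffD1, OF order_trans]) simp
    then have "pi * (1 + x\<^sup>2) \<le> pi * (1 + 4 * L\<^sup>2)" by (intro mult_left_mono) (simp_all add: power_mult_distrib)
    then show "pi * (1 + x\<^sup>2) \<le> pi * (1 + 4 * L\<^sup>2) + 16 * L" using L by linarith
  qed simp
  finally show ?thesis .
next
  case False
  obtain u where u: "c < u" "u < d"
    "arctan ((d - x) / y) - arctan ((c - x) / y) = (d - c) * poisson_kernel (Complex u y) x"
    using MVT2[OF cd(1), of "\<lambda>u. arctan ((u - x) / y)" "\<lambda>u. poisson_kernel (Complex u y) x"]
      DERIV_arctan_poisson_kernel[OF y(1)] by blast
  have xu: "\<bar>x - u\<bar> \<ge> \<bar>x\<bar> / 2" using u cd False by linarith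
  have x1: "\<bar>x\<bar> \<ge> 1" using False L by linarith
  have "x\<^sup>2 / 4 = (\<bar>x\<bar> / 2)\<^sup>2" by (simp add: power_divide)
  also have "\<dots> \<le> \<bar>x - u\<bar>\<^sup>2" using xu by (rule power_mono) simp
  also have "\<dots> \<le> (x - u)\<^sup>2 + y\<^sup>2" by simp
  finally have "x\<^sup>2 / 4 \<le> (x - u)\<^sup>2 + y\<^sup>2" .
  moreover have "1 \<le> x\<^sup>2" using power_mono[OF x1, of 2] by simp
  ultimately have "(1 + x\<^sup>2) / 8 \<le> (x - u)\<^sup>2 + y\<^sup>2" by simp
  then have "y / ((x - u)\<^sup>2 + y\<^sup>2) \<le> 1 / ((1 + x\<^sup>2) / 8)"
    using y by (intro frac_le) (auto intro: add_pos_nonneg)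
  then have P: "poisson_kernel (Complex u y) x \<le> 8 * (1 / (1 + x\<^sup>2))" by (simp add: poisson_kernel_def)
  have "(d - c) * poisson_kernel (Complex u y) x \<le> (2 * L) * (8 * (1 / (1 + x\<^sup>2)))"
    using cd L y by (intro mult_mono P poisson_kernel_nonneg) auto
  also have "\<dots> = 16 * L * (1 / (1 + x\<^sup>2))" by simp
  also have "\<dots> \<le> (pi * (1 + 4 * L\<^sup>2) + 16 * L) * (1 / (1 + x\<^sup>2))"
    by (rule mult_right_mono) (auto intro!: mult_nonneg_nonneg)
  finally show ?thesis using u(3) by simp
qed

text \<open>
  Shrinking the scale \<open>y = \<epsilon>\<^sup>2\<close> faster than the shift \<open>\<epsilon> = 1 / (k + 1)\<close> makes the limit at \<open>s = 0\<close>
  equal to \<open>\<pi> / 2\<close> instead of \<open>0\<close>. In this way Stieltjes inversion yields the mass of closed intervals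
  directly, instead of the usual version that counts endpoints with weight one half.
\<close>

lemma tendsto_arctan_ramp:
  "(\<lambda>k::nat. arctan ((s + 1 / Suc k) / (1 / Suc k)\<^sup>2)) \<longlonglongrightarrow> (if s \<ge> 0 then pi / 2 else - (pi / 2))"
proof (cases "s \<ge> 0")
  case True
  have "filterlim (\<lambda>k::nat. (s + 1 / Suc k) / (1 / Suc k)\<^sup>2) at_top sequentially"
  proof (rule filterlim_at_top_mono[OF filterlim_real_sequentially always_eventually], rule allI)
    fix k :: nat
    have "(s + 1 / Suc k) / (1 / Suc k)\<^sup>2 = s * (real (Suc k))\<^sup>2 + Suc k"
      by (simp add: field_simps power2_eq_square)
    moreover have "0 \<le> s * (real (Suc k))\<^sup>2" using True by simp
    ultimately show "real k \<le> (s + 1 / Suc k) / (1 / Suc k)\<^sup>2" by linarith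
  qed
  from filterlim_compose[OF tendsto_arctan_at_top this] True show ?thesis by simp
next
  case False
  have "filterlim (\<lambda>k::nat. (s + 1 / Suc k) / (1 / Suc k)\<^sup>2) at_bot sequentially"
    using False by real_asymp
  from filterlim_compose[OF tendsto_arctan_at_bot this] False show ?thesis by simp
qed

lemma UN_Icc_eq_UNIV: "(\<Union>n::nat. {- real n..real n}) = UNIV"
proof (rule UNIV_eq_I[symmetric])
  fix x :: real
  obtain n :: nat where "\<bar>x\<bar> \<le> real n" using real_arch_simple by blast
  then have "x \<in> {- real n..real n}" by (simp add: abs_le_iff)
  then show "x \<in> (\<Union>n::nat. {- real n..real n})" by blast
qed

text \<open>
  The measure may be infinite. Existence of the transform makes it finite on compact intervals and
  hence sigma-finite, as Tonelli's theorem requires.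
\<close>

locale stieltjes_transformable =
  fixes \<nu> :: "real measure"
  assumes sets_eq: "sets \<nu> = sets borel"
    and integrable_stieltjes: "\<And>z. Im z > 0 \<Longrightarrow> integrable \<nu> (\<lambda>x. 1 / (complex_of_real x - z))"
begin

lemma measurable_eq: "measurable \<nu> N = measurable borel N"
  by (rule measurable_cong_sets) (simp_all add: sets_eq)

lemma nn_integral_poisson_kernel:
  assumes "Im z > 0"
  shows "(\<integral>\<^sup>+x. ennreal (poisson_kernel z x) \<partial>\<nu>) = ennreal (Im (\<integral>x. 1 / (complex_of_real x - z) \<partial>\<nu>))"
proof -
  have "integrable \<nu> (\<lambda>x. Im (1 / (complex_of_real x - z)))"
    using integrable_stieltjes[OF assms] by (rule integrable_Im)
  then have "integrable \<nu> (poisson_kernel z)" by (simp only: Im_stieltjes_kernel)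
  then have "(\<integral>\<^sup>+x. ennreal (poisson_kernel z x) \<partial>\<nu>) = ennreal (\<integral>x. poisson_kernel z x \<partial>\<nu>)"
    using assms by (intro nn_integral_eq_integral AE_I2 poisson_kernel_nonneg)
  also have "(\<integral>x. poisson_kernel z x \<partial>\<nu>) = (\<integral>x. Im (1 / (complex_of_real x - z)) \<partial>\<nu>)"
    by (simp only: Im_stieltjes_kernel)
  also have "\<dots> = Im (\<integral>x. 1 / (complex_of_real x - z) \<partial>\<nu>)"
    using integrable_stieltjes[OF assms] by (rule integral_Im)
  finally show ?thesis .
qed

lemma nn_integral_inverse_1_plus_square_finite:
  assumes "C \<ge> 0"
  shows "(\<integral>\<^sup>+x. ennreal (C * (1 / (1 + x\<^sup>2))) \<partial>\<nu>) < \<infinity>"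
proof -
  have "(\<integral>\<^sup>+x. ennreal (C * (1 / (1 + x\<^sup>2))) \<partial>\<nu>) = (\<integral>\<^sup>+x. ennreal C * ennreal (poisson_kernel \<i> x) \<partial>\<nu>)"
    using assms by (intro nn_integral_cong) (simp add: poisson_kernel_def add.commute flip: ennreal_mult)
  also have "\<dots> = ennreal C * (\<integral>\<^sup>+x. ennreal (poisson_kernel \<i> x) \<partial>\<nu>)"
    by (rule nn_integral_cmult) (simp add: measurable_eq poisson_kernel_def)
  finally show ?thesis by (simp add: nn_integral_poisson_kernel ennreal_mult_less_top)
qed

lemma emeasure_Icc_finite: "emeasure \<nu> {c..d} \<noteq> \<infinity>"
proof -
  define m where "m = max \<bar>c\<bar> \<bar>d\<bar>"
  have "emeasure \<nu> {c..d} = (\<integral>\<^sup>+x. indicator {c..d} x \<partial>\<nu>)"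
    by (simp add: sets_eq)
  also have "\<dots> \<le> (\<integral>\<^sup>+x. ennreal ((1 + m\<^sup>2) * (1 / (1 + x\<^sup>2))) \<partial>\<nu>)"
  proof (rule nn_integral_mono)
    fix x
    show "indicator {c..d} x \<le> ennreal ((1 + m\<^sup>2) * (1 / (1 + x\<^sup>2)))"
    proof (cases "x \<in> {c..d}")
      case True
      then have "\<bar>x\<bar> \<le> m" by (auto simp: m_def)
      then have "x\<^sup>2 \<le> m\<^sup>2" using power_mono[of "\<bar>x\<bar>" m 2] by simp
      then have "1 \<le> (1 + m\<^sup>2) * (1 / (1 + x\<^sup>2))"
        by (simp add: le_divide_eq add_pos_nonneg)
      then show ?thesis using True by (simp add: ennreal_1[symmetric] del: ennreal_1)
    qed simp
  qed
  also have "\<dots> < \<infinity>" by (rule nn_integral_inverse_1_plus_square_finite) simp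
  finally show ?thesis by (rule less_imp_neq)
qed

sublocale sigma_finite_measure \<nu>
proof
  have "space \<nu> = UNIV" using sets_eq_imp_space_eq[OF sets_eq] by simp
  then show "\<exists>A. countable A \<and> A \<subseteq> sets \<nu> \<and> \<Union>A = space \<nu> \<and> (\<forall>a\<in>A. emeasure \<nu> a \<noteq> \<infinity>)"
    using emeasure_Icc_finite UN_Icc_eq_UNIV
    by (intro exI[of _ "range (\<lambda>n::nat. {- real n..real n})"]) (auto simp: sets_eq)
qed

text \<open>
  Integrating the imaginary part of the transform along a horizontal segment: by Tonelli's theorem
  the integration can be carried out on the Poisson kernel first, where the antiderivative is an
  arcus tangent. The right-hand side depends on the measure only through its transform.
\<close>

lemma nn_integral_arctan_diff:
  assumes "y > 0" "c \<le> d"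
  shows "(\<integral>\<^sup>+x. ennreal (arctan ((d - x) / y) - arctan ((c - x) / y)) \<partial>\<nu>)
    = (\<integral>\<^sup>+u. ennreal (Im (\<integral>x. 1 / (complex_of_real x - Complex u y) \<partial>\<nu>)) * indicator {c..d} u \<partial>lborel)"
proof -
  interpret pair_sigma_finite lborel \<nu> ..
  have [measurable_cong]: "sets \<nu> = sets borel" by (rule sets_eq)
  have "(\<integral>\<^sup>+x. ennreal (arctan ((d - x) / y) - arctan ((c - x) / y)) \<partial>\<nu>)
    = (\<integral>\<^sup>+x. (\<integral>\<^sup>+u. ennreal (poisson_kernel (Complex u y) x) * indicator {c..d} u \<partial>lborel) \<partial>\<nu>)"
    using assms by (simp add: nn_integral_poisson_kernel_Icc)
  also have "\<dots> = (\<integral>\<^sup>+u. (\<integral>\<^sup>+x. ennreal (poisson_kernel (Complex u y) x) * indicator {c..d} u \<partial>\<nu>) \<partial>lborel)"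
    by (rule Fubini') (simp add: poisson_kernel_def split_beta')
  also have "\<dots> = (\<integral>\<^sup>+u. (\<integral>\<^sup>+x. ennreal (poisson_kernel (Complex u y) x) \<partial>\<nu>) * indicator {c..d} u \<partial>lborel)"
    by (intro nn_integral_cong nn_integral_multc) (simp add: poisson_kernel_def)
  finally show ?thesis using assms(1) by (simp add: nn_integral_poisson_kernel)
qed

text \<open>
  Stieltjes inversion: the segments lie above \<open>[c - \<epsilon>, d + \<epsilon>]\<close> at height \<open>\<epsilon>\<^sup>2\<close>, for \<open>\<epsilon> = 1 / (k + 1)\<close>.
\<close>

lemma tendsto_emeasure_Icc:
  assumes "c \<le> d"
  shows "(\<lambda>k::nat. \<integral>\<^sup>+x. ennreal (arctan ((d + 1 / Suc k - x) / (1 / Suc k)\<^sup>2)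
            - arctan ((c - 1 / Suc k - x) / (1 / Suc k)\<^sup>2)) \<partial>\<nu>)
         \<longlonglongrightarrow> ennreal pi * emeasure \<nu> {c..d}"
proof -
  have [measurable_cong]: "sets \<nu> = sets borel" by (rule sets_eq)
  let ?g = "\<lambda>k x. arctan ((d + 1 / Suc k - x) / (1 / Suc k)\<^sup>2) - arctan ((c - 1 / Suc k - x) / (1 / Suc k)\<^sup>2)"
  define L where "L = \<bar>c\<bar> + \<bar>d\<bar> + 1"
  define K where "K = pi * (1 + 4 * L\<^sup>2) + 16 * L"
  have "L \<ge> 0" unfolding L_def by linarith
  then have K: "K \<ge> 0" unfolding K_def by (intro add_nonneg_nonneg mult_nonneg_nonneg) simp_all
  have lim: "(\<lambda>k::nat. ?g k x) \<longlonglongrightarrow> pi * indicator {c..d} x" for x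
  proof -
    have "(\<lambda>k::nat. arctan ((d - x + 1 / Suc k) / (1 / Suc k)\<^sup>2) + arctan ((x - c + 1 / Suc k) / (1 / Suc k)\<^sup>2))
      \<longlonglongrightarrow> (if d - x \<ge> 0 then pi / 2 else - (pi / 2)) + (if x - c \<ge> 0 then pi / 2 else - (pi / 2))"
      by (intro tendsto_add tendsto_arctan_ramp)
    moreover have "?g k x = arctan ((d - x + 1 / Suc k) / (1 / Suc k)\<^sup>2) + arctan ((x - c + 1 / Suc k) / (1 / Suc k)\<^sup>2)" for k :: nat
    proof -
      have "(c - 1 / Suc k - x) / (1 / Suc k)\<^sup>2 = - ((x - c + 1 / Suc k) / (1 / Suc k)\<^sup>2)"
        unfolding minus_divide_left by simp
      moreover have "d + 1 / Suc k - x = d - x + 1 / Suc k" by simp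
      ultimately show ?thesis by (simp only: arctan_minus diff_minus_eq_add)
    qed
    moreover have "(if d - x \<ge> 0 then pi / 2 else - (pi / 2)) + (if x - c \<ge> 0 then pi / 2 else - (pi / 2)) = pi * indicator {c..d} x"
      using assms by (auto simp: indicator_def)
    ultimately show ?thesis by (simp only:)
  qed
  have "(\<lambda>k::nat. \<integral>\<^sup>+x. ennreal (?g k x) \<partial>\<nu>) \<longlonglongrightarrow> (\<integral>\<^sup>+x. ennreal (pi * indicator {c..d} x) \<partial>\<nu>)"
  proof (rule nn_integral_dominated_convergence[where w = "\<lambda>x. ennreal (K * (1 / (1 + x\<^sup>2)))"])
    show "(\<integral>\<^sup>+x. ennreal (K * (1 / (1 + x\<^sup>2))) \<partial>\<nu>) < \<infinity>"
      by (rule nn_integral_inverse_1_plus_square_finite[OF K])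
    show "AE x in \<nu>. (\<lambda>k. ennreal (?g k x)) \<longlonglongrightarrow> ennreal (pi * indicator {c..d} x)"
      using lim by (intro AE_I2 tendsto_ennrealI)
    show "AE x in \<nu>. ennreal (?g k x) \<le> ennreal (K * (1 / (1 + x\<^sup>2)))" for k :: nat
    proof (intro AE_I2 ennreal_leI)
      fix x
      have k: "0 < 1 / real (Suc k)" "1 / real (Suc k) \<le> 1" by simp_all
      show "?g k x \<le> K * (1 / (1 + x\<^sup>2))"
        unfolding K_def
      proof (rule arctan_diff_le)
        show "0 < (1 / real (Suc k))\<^sup>2" by simp
        show "(1 / real (Suc k))\<^sup>2 \<le> 1" using k by (intro power_le_one) linarith+
      qed (use k assms in \<open>unfold L_def, linarith+\<close>)
    qed
  qed (unfold measurable_eq, simp_all)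
  also have "(\<integral>\<^sup>+x. ennreal (pi * indicator {c..d} x) \<partial>\<nu>) = (\<integral>\<^sup>+x. ennreal pi * indicator {c..d} x \<partial>\<nu>)"
    by (intro nn_integral_cong) (simp add: indicator_def)
  also have "\<dots> = ennreal pi * emeasure \<nu> {c..d}"
    by (simp add: nn_integral_cmult_indicator)
  finally show ?thesis .
qed

end

lemma stieltjes_transform_unique:
  assumes "stieltjes_transformable \<mu>" "stieltjes_transformable \<nu>"
    and eq: "\<And>z. Im z > 0 \<Longrightarrow>
      (\<integral>x. 1 / (complex_of_real x - z) \<partial>\<mu>) = (\<integral>x. 1 / (complex_of_real x - z) \<partial>\<nu>)"
  shows "\<mu> = \<nu>"
proof -
  interpret m: stieltjes_transformable \<mu> by fact
  interpret n: stieltjes_transformable \<nu> by fact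
  have Icc: "emeasure \<mu> {c..d} = emeasure \<nu> {c..d}" if cd: "c \<le> d" for c d :: real
  proof -
    let ?S = "\<lambda>\<mu> k. \<integral>\<^sup>+x. ennreal (arctan ((d + 1 / Suc k - x) / (1 / Suc k)\<^sup>2)
            - arctan ((c - 1 / Suc k - x) / (1 / Suc k)\<^sup>2)) \<partial>\<mu>"
    have "?S \<mu> k = ?S \<nu> k" for k :: nat
    proof -
      have y: "0 < (1 / real (Suc k))\<^sup>2" by simp
      have "c - 1 / Suc k \<le> c" "d \<le> d + 1 / Suc k" by simp_all
      then have "c - 1 / Suc k \<le> d + 1 / Suc k" using cd by linarith
      note arctan_diff = m.nn_integral_arctan_diff[OF y this] n.nn_integral_arctan_diff[OF y this]
      have "(\<integral>x. 1 / (complex_of_real x - Complex u ((1 / real (Suc k))\<^sup>2)) \<partial>\<mu>)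
          = (\<integral>x. 1 / (complex_of_real x - Complex u ((1 / real (Suc k))\<^sup>2)) \<partial>\<nu>)" for u
        using y by (intro eq) (simp only: complex.sel)
      then show ?thesis unfolding arctan_diff by (intro nn_integral_cong) (simp only:)
    qed
    then have "?S \<mu> = ?S \<nu>" by (rule ext)
    with m.tendsto_emeasure_Icc[OF cd] have "?S \<nu> \<longlonglongrightarrow> ennreal pi * emeasure \<mu> {c..d}"
      by (simp only:)
    then have "ennreal pi * emeasure \<mu> {c..d} = ennreal pi * emeasure \<nu> {c..d}"
      using n.tendsto_emeasure_Icc[OF cd] by (rule LIMSEQ_unique)
    then show ?thesis by (simp add: ennreal_mult_cancel_left)
  qed
  show ?thesis
  proof (rule measure_eqI_generator_eq[where \<Omega> = UNIV and E = "range (\<lambda>(c, d::real). {c..d})"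
        and A = "\<lambda>i::nat. {- real i..real i}"])
    show "Int_stable (range (\<lambda>(c, d::real). {c..d}))"
      by (auto simp: Int_stable_def)
    show "emeasure \<mu> X = emeasure \<nu> X" if X_in: "X \<in> range (\<lambda>(c, d::real). {c..d})" for X
    proof -
      obtain c d where X: "X = {c..d}" using X_in by (auto simp: case_prod_beta)
      show ?thesis by (cases "c \<le> d") (simp_all add: X Icc)
    qed
    have "sets borel = sigma_sets UNIV (range (\<lambda>(c, d::real). {c..d}))"
      by (subst borel_eq_atLeastAtMost) simp
    then show "sets \<mu> = sigma_sets UNIV (range (\<lambda>(c, d::real). {c..d}))"
      "sets \<nu> = sigma_sets UNIV (range (\<lambda>(c, d::real). {c..d}))"
      by (simp_all add: m.sets_eq n.sets_eq)
    show "(\<Union>i::nat. {- real i..real i}) = UNIV" by (rule UN_Icc_eq_UNIV)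
    show "emeasure \<mu> {- real i..real i} \<noteq> \<infinity>" for i
      by (rule m.emeasure_Icc_finite)
  qed auto
qed

section \<open>Polynomials of the first and second kind\<close>

text \<open>
  The orthonormal polynomials as functions on the complex plane, generated from the Jacobi
  parameters alone. With a recursion instead of mapped coefficient lists, holomorphy and asymptotics are
  plain inductions.
\<close>

fun first_kind :: "(nat \<Rightarrow> real) \<Rightarrow> (nat \<Rightarrow> real) \<Rightarrow> nat \<Rightarrow> complex \<Rightarrow> complex" where
  "first_kind a b 0 z = 1"
| "first_kind a b (Suc 0) z = (z - of_real (b 1)) / of_real (a 1)"
| "first_kind a b (Suc (Suc k)) z =
    ((z - of_real (b (Suc (Suc k)))) * first_kind a b (Suc k) z
       - of_real (a (Suc k)) * first_kind a b k z) / of_real (a (Suc (Suc k)))"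

text \<open>
  The solution of the same recurrence with initial values \<open>0\<close> and \<open>1 / a\<^sub>1\<close>. Up to this factor it is
  the first-kind sequence of the Jacobi matrix with its first row and column removed, so that facts
  on \<open>first_kind\<close> carry over.
\<close>

fun second_kind :: "(nat \<Rightarrow> real) \<Rightarrow> (nat \<Rightarrow> real) \<Rightarrow> nat \<Rightarrow> complex \<Rightarrow> complex" where
  "second_kind a b 0 z = 0"
| "second_kind a b (Suc k) z = first_kind (a \<circ> Suc) (b \<circ> Suc) k z / of_real (a 1)"

lemma holomorphic_first_kind: "(\<lambda>z. first_kind a b k z) holomorphic_on S"
proof -
  have "(\<lambda>z. first_kind a b k z) holomorphic_on S \<and> (\<lambda>z. first_kind a b (Suc k) z) holomorphic_on S"
  proof (induction k)
    case 0
    show ?case unfolding first_kind.simps divide_inverse by (intro conjI holomorphic_intros)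
  next
    case (Suc k)
    then show ?case unfolding first_kind.simps(3) divide_inverse
      by (intro conjI holomorphic_intros) simp_all
  qed
  then show ?thesis by blast
qed

lemma holomorphic_second_kind: "(\<lambda>z. second_kind a b k z) holomorphic_on S"
proof (cases k)
  case 0
  show ?thesis unfolding 0 second_kind.simps by (intro holomorphic_intros)
next
  case (Suc j)
  show ?thesis unfolding Suc second_kind.simps divide_inverse
    by (intro holomorphic_intros holomorphic_first_kind)
qed

lemma Im_first_kind_of_real: "Im (first_kind a b k (of_real x)) = 0"
proof -
  have "Im (first_kind a b k (of_real x)) = 0 \<and> Im (first_kind a b (Suc k) (of_real x)) = 0"
    by (induction k) simp_all
  then show ?thesis by blast
qed

lemma Im_second_kind_of_real: "Im (second_kind a b k (of_real x)) = 0"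
  by (cases k) (simp_all add: Im_first_kind_of_real)

lemma first_kind_recurrence:
  assumes "a (Suc k) \<noteq> 0"
  shows "of_real (a (Suc k)) * first_kind a b (Suc k) z =
    (z - of_real (b (Suc k))) * first_kind a b k z - (if k = 0 then 0 else of_real (a k) * first_kind a b (k - 1) z)"
  using assms by (cases k) simp_all

text \<open>
  The inhomogeneous term in the first equation is what makes this sequence solve \<open>(J - z) x = \<delta>\<close>.
\<close>

lemma second_kind_recurrence:
  assumes "\<And>k. a (Suc k) \<noteq> 0"
  shows "of_real (a (Suc k)) * second_kind a b (Suc k) z =
    (z - of_real (b (Suc k))) * second_kind a b k z - (if k = 0 then 0 else of_real (a k) * second_kind a b (k - 1) z)
    + (if k = 0 then 1 else 0)"
proof (cases k)
  case 0
  then show ?thesis using assms[of 0] by simp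
next
  case (Suc j)
  have "of_real ((a \<circ> Suc) (Suc j)) * first_kind (a \<circ> Suc) (b \<circ> Suc) (Suc j) z =
      (z - of_real ((b \<circ> Suc) (Suc j))) * first_kind (a \<circ> Suc) (b \<circ> Suc) j z
      - (if j = 0 then 0 else of_real ((a \<circ> Suc) j) * first_kind (a \<circ> Suc) (b \<circ> Suc) (j - 1) z)"
    by (rule first_kind_recurrence) (simp add: assms)
  then show ?thesis
    by (cases j) (simp_all add: Suc assms flip: diff_divide_distrib)
qed

lemma wronskian:
  assumes "\<And>k. a (Suc k) \<noteq> 0"
  shows "of_real (a (Suc k)) * (second_kind a b (Suc k) z * first_kind a b k z
           - second_kind a b k z * first_kind a b (Suc k) z) = 1"
proof (induction k)
  case 0
  then show ?case using assms[of 0] by simp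
next
  case (Suc k)
  let ?P = "\<lambda>k. first_kind a b k z" and ?Q = "\<lambda>k. second_kind a b k z"
  have "of_real (a (Suc (Suc k))) * (?Q (Suc (Suc k)) * ?P (Suc k) - ?Q (Suc k) * ?P (Suc (Suc k)))
    = (of_real (a (Suc (Suc k))) * ?Q (Suc (Suc k))) * ?P (Suc k) - ?Q (Suc k) * (of_real (a (Suc (Suc k))) * ?P (Suc (Suc k)))"
    by (simp only: right_diff_distrib mult_ac)
  also have "\<dots> = of_real (a (Suc k)) * (?Q (Suc k) * ?P k - ?Q k * ?P (Suc k))"
    unfolding second_kind_recurrence[of a "Suc k", OF assms] first_kind_recurrence[of a "Suc k", OF assms]
    by (simp only: nat.simps if_False diff_Suc_1 add_0_right) (simp only: algebra_simps)
  finally show ?case using Suc by simp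
qed

text \<open>
  The Christoffel-Darboux formula on the diagonal: multiply the recurrence by \<open>cnj P\<^sub>k\<close>, take imaginary
  parts and telescope.
\<close>

lemma Im_cnj_first_kind:
  assumes "\<And>k. a (Suc k) \<noteq> 0"
  shows "Im (cnj (first_kind a b k z) * (of_real (a (Suc k)) * first_kind a b (Suc k) z))
    = Im z * (\<Sum>j\<le>k. (norm (first_kind a b j z))\<^sup>2)"
proof (induction k)
  case 0
  then show ?case using assms[of 0] by simp
next
  case (Suc k)
  let ?P = "\<lambda>k. first_kind a b k z"
  have "cnj (?P (Suc k)) * (of_real (a (Suc (Suc k))) * ?P (Suc (Suc k)))
    = (z - of_real (b (Suc (Suc k)))) * (?P (Suc k) * cnj (?P (Suc k))) - cnj (?P (Suc k)) * (of_real (a (Suc k)) * ?P k)"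
    unfolding first_kind_recurrence[of a "Suc k", OF assms]
    by (simp only: nat.simps if_False diff_Suc_1) (simp only: algebra_simps)
  also have "Im \<dots> = Im z * (norm (?P (Suc k)))\<^sup>2 - Im (cnj (?P (Suc k)) * (of_real (a (Suc k)) * ?P k))"
    unfolding complex_norm_square[symmetric] by simp
  also have "Im (cnj (?P (Suc k)) * (of_real (a (Suc k)) * ?P k)) = - Im (cnj (?P k) * (of_real (a (Suc k)) * ?P (Suc k)))"
    by (simp add: algebra_simps)
  finally show ?case using Suc by (simp add: algebra_simps)
qed

text \<open>
  If \<open>\<beta> P\<^sub>m = a\<^sub>n P\<^sub>n\<close>, then the Christoffel-Darboux formula equates a nonnegative multiple of \<open>Im z\<close> with
  a nonnegative multiple of \<open>Im \<beta>\<close>, so both vanish. For \<open>Im z > 0\<close> this contradicts \<open>P\<^sub>0 = 1\<close>; for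
  \<open>Im \<beta> < 0\<close> it makes \<open>P\<^sub>m\<close> and \<open>P\<^sub>n\<close> vanish together, which the Wronskian forbids. The hypotheses
  cover real \<open>\<beta>\<close> with \<open>z\<close> above the real line, as needed for inverting the matrix, and also \<open>\<beta> = -\<i>\<close>
  with \<open>z\<close> on the real line, as needed for the boundary values.
\<close>

lemma first_kind_boundary_condition_nonzero:
  assumes a: "\<And>k. a (Suc k) \<noteq> 0" and "Im z \<ge> 0" "Im \<beta> \<le> 0" "Im z > 0 \<or> Im \<beta> < 0"
  shows "\<beta> * first_kind a b m z - of_real (a (Suc m)) * first_kind a b (Suc m) z \<noteq> 0"
proof
  let ?P = "\<lambda>k. first_kind a b k z"
  let ?N = "\<Sum>j\<le>m. (norm (?P j))\<^sup>2"
  assume 0: "\<beta> * ?P m - of_real (a (Suc m)) * ?P (Suc m) = 0"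
  then have "cnj (?P m) * (of_real (a (Suc m)) * ?P (Suc m)) = \<beta> * (?P m * cnj (?P m))" by simp
  also have "\<dots> = \<beta> * of_real ((norm (?P m))\<^sup>2)" by (simp only: complex_norm_square)
  finally have eq: "Im z * ?N = Im \<beta> * (norm (?P m))\<^sup>2"
    using Im_cnj_first_kind[of a b m z, OF a] by simp
  have "1 = (norm (?P 0))\<^sup>2" by simp
  also have "\<dots> \<le> ?N" by (rule member_le_sum) auto
  finally have N: "?N \<ge> 1" .
  have "Im z * ?N \<ge> 0" using assms(2) N by simp
  moreover have "Im \<beta> * (norm (?P m))\<^sup>2 \<le> 0" using assms(3) by (simp add: mult_nonpos_nonneg)
  ultimately have *: "Im z * ?N = 0" "Im \<beta> * (norm (?P m))\<^sup>2 = 0" using eq by linarith+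
  with N assms(4) have "?P m = 0" by auto
  moreover from this 0 a have "?P (Suc m) = 0" by simp
  ultimately show False using wronskian[of a m b z, OF a] by simp
qed

lemma first_kind_nonzero:
  assumes "\<And>k. a (Suc k) \<noteq> 0" "Im z > 0"
  shows "first_kind a b m z \<noteq> 0"
proof
  assume 0: "first_kind a b m z = 0"
  have "1 = (norm (first_kind a b 0 z))\<^sup>2" by simp
  also have "\<dots> \<le> (\<Sum>j\<le>m. (norm (first_kind a b j z))\<^sup>2)" by (rule member_le_sum) auto
  finally show False using Im_cnj_first_kind[of a b m z, OF assms(1)] assms(2) 0 by simp
qed

lemma first_kind_asymptotics:
  assumes "\<And>k. a (Suc k) \<noteq> 0"
  shows "((\<lambda>z. first_kind a b k z / z ^ k) \<longlongrightarrow> of_real (\<Prod>j=1..k. 1 / a j)) at_infinity"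
proof -
  let ?c = "\<lambda>k. complex_of_real (\<Prod>j=1..k. 1 / a j)"
  have inv: "((\<lambda>z::complex. inverse z) \<longlongrightarrow> 0) at_infinity" by (rule tendsto_inverse_0)
  have step: "((\<lambda>z. first_kind a b (Suc k) z / z ^ Suc k) \<longlongrightarrow> ?c (Suc k)) at_infinity"
    if k: "((\<lambda>z. first_kind a b k z / z ^ k) \<longlongrightarrow> ?c k) at_infinity"
      and k1: "k > 0 \<Longrightarrow> ((\<lambda>z. first_kind a b (k - 1) z / z ^ (k - 1)) \<longlongrightarrow> ?c (k - 1)) at_infinity" for k
  proof -
    \<comment> \<open>the term of index \<open>k - 1\<close>, divided by \<open>z ^ (k + 1)\<close>\<close>
    let ?r = "\<lambda>z. if k = 0 then 0 else of_real (a k) * (first_kind a b (k - 1) z / z ^ (k - 1)) * inverse z * inverse z"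
    have r: "(?r \<longlongrightarrow> 0) at_infinity"
    proof (cases "k = 0")
      case False
      then have "((\<lambda>z. of_real (a k) * (first_kind a b (k - 1) z / z ^ (k - 1)) * inverse z * inverse z)
           \<longlongrightarrow> of_real (a k) * ?c (k - 1) * 0 * 0) at_infinity"
        by (intro tendsto_mult tendsto_const k1 inv) simp
      with False show ?thesis by simp
    qed simp
    have "((\<lambda>z. ((1 - of_real (b (Suc k)) * inverse z) * (first_kind a b k z / z ^ k) - ?r z) / of_real (a (Suc k)))
       \<longlongrightarrow> ((1 - of_real (b (Suc k)) * 0) * ?c k - 0) / of_real (a (Suc k))) at_infinity"
      using assms[of k] by (intro tendsto_intros k r inv) simp
    moreover have "\<forall>\<^sub>F z in at_infinity.
        ((1 - of_real (b (Suc k)) * inverse z) * (first_kind a b k z / z ^ k) - ?r z) / of_real (a (Suc k))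
        = first_kind a b (Suc k) z / z ^ Suc k"
      using eventually_not_equal_at_infinity[of 0]
    proof eventually_elim
      case (elim z)
      have "first_kind a b (Suc k) z = ((z - of_real (b (Suc k))) * first_kind a b k z
          - (if k = 0 then 0 else of_real (a k) * first_kind a b (k - 1) z)) / of_real (a (Suc k))"
        using first_kind_recurrence[of a k b z] assms[of k] by (simp add: nonzero_eq_divide_eq mult.commute)
      then have "first_kind a b (Suc k) z / z ^ Suc k = ((z - of_real (b (Suc k))) * first_kind a b k z / z ^ Suc k
          - (if k = 0 then 0 else of_real (a k) * first_kind a b (k - 1) z) / z ^ Suc k) / of_real (a (Suc k))"
        by (simp add: diff_divide_distrib mult.commute)
      also have "(z - of_real (b (Suc k))) * first_kind a b k z / z ^ Suc k
          = (1 - of_real (b (Suc k)) * inverse z) * (first_kind a b k z / z ^ k)"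
        using elim by (simp add: divide_simps)
      also have "(if k = 0 then 0 else of_real (a k) * first_kind a b (k - 1) z) / z ^ Suc k = ?r z"
        using elim by (cases k) (simp_all add: divide_inverse mult_ac)
      finally show ?case by (rule sym)
    qed
    ultimately show ?thesis by (simp add: tendsto_cong)
  qed
  have "((\<lambda>z. first_kind a b k z / z ^ k) \<longlongrightarrow> ?c k) at_infinity
    \<and> ((\<lambda>z. first_kind a b (Suc k) z / z ^ Suc k) \<longlongrightarrow> ?c (Suc k)) at_infinity"
  proof (induction k)
    case 0
    have 0: "((\<lambda>z. first_kind a b 0 z / z ^ 0) \<longlongrightarrow> ?c 0) at_infinity" by simp
    then show ?case using step[OF 0] by blast
  next
    case (Suc k)
    then show ?case using step[of "Suc k"] by simp
  qed
  then show ?thesis by blast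
qed

lemma second_kind_asymptotics:
  assumes "\<And>k. a (Suc k) \<noteq> 0"
  obtains c where "((\<lambda>z. second_kind a b (Suc k) z / z ^ k) \<longlongrightarrow> c) at_infinity"
    and "((\<lambda>z. second_kind a b k z / z ^ k) \<longlongrightarrow> 0) at_infinity"
proof -
  have lim: "\<exists>c. ((\<lambda>z. second_kind a b (Suc k) z / z ^ k) \<longlongrightarrow> c) at_infinity" for k
  proof -
    have "((\<lambda>z. first_kind (a \<circ> Suc) (b \<circ> Suc) k z / z ^ k / of_real (a 1))
      \<longlongrightarrow> of_real (\<Prod>j=1..k. 1 / (a \<circ> Suc) j) / of_real (a 1)) at_infinity"
      using assms[of 0] by (intro tendsto_divide tendsto_const first_kind_asymptotics) (simp_all add: assms)
    moreover have "(\<lambda>z. first_kind (a \<circ> Suc) (b \<circ> Suc) k z / z ^ k / of_real (a 1)) = (\<lambda>z. second_kind a b (Suc k) z / z ^ k)"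
      by (simp add: fun_eq_iff)
    ultimately show ?thesis by (intro exI) (simp only:)
  qed
  have "((\<lambda>z. second_kind a b k z / z ^ k) \<longlongrightarrow> 0) at_infinity"
  proof (cases k)
    case (Suc j)
    obtain c where "((\<lambda>z. second_kind a b (Suc j) z / z ^ j) \<longlongrightarrow> c) at_infinity" using lim by blast
    then have "((\<lambda>z. second_kind a b (Suc j) z / z ^ j * inverse z) \<longlongrightarrow> c * 0) at_infinity"
      by (intro tendsto_mult tendsto_inverse_0)
    moreover have "second_kind a b (Suc j) z / z ^ j * inverse z = second_kind a b k z / z ^ k" for z
      by (simp add: Suc divide_simps)
    ultimately show ?thesis by (simp only: mult_zero_right)
  qed simp
  with lim[of k] that show ?thesis by blast
qed

section \<open>The resolvent of the perturbed Jacobi matrix\<close>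

text \<open>
  The \<open>m\<close>-function of the perturbed matrix, continued to complex values \<open>\<beta>\<close> of the perturbation.
\<close>

definition transfer_fraction :: "(nat \<Rightarrow> real) \<Rightarrow> (nat \<Rightarrow> real) \<Rightarrow> nat \<Rightarrow> complex \<Rightarrow> complex \<Rightarrow> complex" where
  "transfer_fraction a b m \<beta> z =
     (of_real (a (Suc m)) * second_kind a b (Suc m) z - \<beta> * second_kind a b m z)
     / (\<beta> * first_kind a b m z - of_real (a (Suc m)) * first_kind a b (Suc m) z)"

lemma jacobi_perturbed_mult_vec:
  fixes v :: "complex vec"
  assumes v: "v \<in> carrier_vec (Suc m)" and i: "i \<le> m"
  shows "((jacobi_perturbed a b (Suc m) \<beta> - z \<cdot>\<^sub>m 1\<^sub>m (Suc m)) *\<^sub>v v) $ i =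
    (if i = 0 then 0 else of_real (a i) * v $ (i - 1)) + (of_real (b (Suc i)) - z) * v $ i
    + (if i = m then of_real \<beta> * v $ i else of_real (a (Suc i)) * v $ Suc i)"
proof -
  let ?A = "jacobi_perturbed a b (Suc m) \<beta> - z \<cdot>\<^sub>m 1\<^sub>m (Suc m)"
  have im: "i - 1 < Suc m" using i by simp
  have "(?A *\<^sub>v v) $ i = (\<Sum>j<Suc m. ?A $$ (i, j) * v $ j)"
    using v i by (simp add: jacobi_perturbed_def scalar_prod_def lessThan_atLeast0 del: sum.lessThan_Suc)
  also have "\<dots> = (\<Sum>j<Suc m. (if j = i - 1 then (if i = 0 then 0 else of_real (a i) * v $ j) else 0)
      + (if j = i then (of_real (b (Suc i)) - z) * v $ j + (if i = m then of_real \<beta> * v $ j else 0) else 0)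
      + (if j = Suc i then of_real (a (Suc i)) * v $ j else 0))"
  proof (rule sum.cong)
    fix j assume "j \<in> {..<Suc m}"
    then show "?A $$ (i, j) * v $ j = (if j = i - 1 then (if i = 0 then 0 else of_real (a i) * v $ j) else 0)
      + (if j = i then (of_real (b (Suc i)) - z) * v $ j + (if i = m then of_real \<beta> * v $ j else 0) else 0)
      + (if j = Suc i then of_real (a (Suc i)) * v $ j else 0)"
      using i by (auto simp: jacobi_perturbed_def jacobi_trunc_def jacobi_entry_def algebra_simps)
  qed simp
  also have "\<dots> = (if i = 0 then 0 else of_real (a i) * v $ (i - 1))
      + ((of_real (b (Suc i)) - z) * v $ i + (if i = m then of_real \<beta> * v $ i else 0))
      + (if i = m then 0 else of_real (a (Suc i)) * v $ Suc i)"
    unfolding sum.distrib using i im by (simp add: sum.delta' sum.delta del: sum.lessThan_Suc)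
  finally show ?thesis by simp
qed

text \<open>
  The first \<open>m\<close> rows of \<open>(J - z) v = 0\<close> force \<open>v\<close> to be a multiple of \<open>(P\<^sub>0, \<dots>, P\<^sub>m)\<close>, and the last row
  then forces the multiple to be zero; hence the matrix is invertible. The explicit vector with
  entries \<open>Q\<^sub>k + M P\<^sub>k\<close> solves \<open>(J - z) x = \<delta>\<close>: all rows but the last hold for every \<open>M\<close>, and the last one
  determines \<open>M\<close>.
\<close>

lemma m_function_eq_transfer_fraction:
  assumes a: "\<And>k. a (Suc k) \<noteq> 0" and z: "Im z > 0"
  shows "m_function a b (Suc m) \<beta> z = transfer_fraction a b m (of_real \<beta>) z"
proof -
  let ?A = "jacobi_perturbed a b (Suc m) \<beta> - z \<cdot>\<^sub>m 1\<^sub>m (Suc m)"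
  let ?P = "\<lambda>k. first_kind a b k z" and ?Q = "\<lambda>k. second_kind a b k z"
  let ?D = "of_real \<beta> * ?P m - of_real (a (Suc m)) * ?P (Suc m)"
  have A: "?A \<in> carrier_mat (Suc m) (Suc m)" by (intro minus_carrier_mat smult_carrier_mat one_carrier_mat)
  have D: "?D \<noteq> 0" by (rule first_kind_boundary_condition_nonzero) (use a z in auto)
  have "det ?A \<noteq> 0"
  proof
    assume "det ?A = 0"
    then obtain v where v: "v \<in> carrier_vec (Suc m)" "v \<noteq> 0\<^sub>v (Suc m)" and Av: "?A *\<^sub>v v = 0\<^sub>v (Suc m)"
      using det_0_iff_vec_prod_zero_field[OF A] by blast
    have row: "(if i = 0 then 0 else of_real (a i) * v $ (i - 1)) + (of_real (b (Suc i)) - z) * v $ i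
      + (if i = m then of_real \<beta> * v $ i else of_real (a (Suc i)) * v $ Suc i) = 0" if "i \<le> m" for i
      using jacobi_perturbed_mult_vec[OF v(1) that, of a b \<beta> z] Av that by simp
    \<comment> \<open>row \<open>k\<close> determines the entry \<open>k + 1\<close> from the two entries before it\<close>
    have vP: "i \<le> m \<Longrightarrow> v $ i = v $ 0 * ?P i" for i
    proof (induction i rule: less_induct)
      case (less i)
      show ?case
      proof (cases i)
        case (Suc k)
        have k: "k \<le> m" "k \<noteq> m" using less.prems Suc by auto
        have vk: "v $ k = v $ 0 * ?P k" using less.IH[of k] Suc k by simp
        have "(if k = 0 then 0 else of_real (a k) * v $ (k - 1)) = v $ 0 * (if k = 0 then 0 else of_real (a k) * ?P (k - 1))"
          using less.IH[of "k - 1"] Suc k by simp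
        with row[OF k(1)] k(2) vk have "of_real (a (Suc k)) * v $ Suc k
            = v $ 0 * ((z - of_real (b (Suc k))) * ?P k - (if k = 0 then 0 else of_real (a k) * ?P (k - 1)))"
          by (simp add: algebra_simps add_eq_0_iff2)
        also have "\<dots> = v $ 0 * (of_real (a (Suc k)) * ?P (Suc k))"
          by (subst first_kind_recurrence[of a k b z, OF a]) simp
        finally show ?thesis using a[of k] Suc by simp
      qed simp
    qed
    have "(if m = 0 then 0 else of_real (a m) * v $ (m - 1)) = v $ 0 * (if m = 0 then 0 else of_real (a m) * ?P (m - 1))"
      using vP[of "m - 1"] by simp
    with row[of m] vP[of m] have "v $ 0 * (of_real \<beta> * ?P m) = v $ 0 * ((z - of_real (b (Suc m))) * ?P m - (if m = 0 then 0 else of_real (a m) * ?P (m - 1)))"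
      by (simp add: algebra_simps add_eq_0_iff2)
    also have "\<dots> = v $ 0 * (of_real (a (Suc m)) * ?P (Suc m))"
      by (subst first_kind_recurrence[of a m b z, OF a]) simp
    finally have "v $ 0 * ?D = 0" by (simp only: right_diff_distrib) simp
    with D have "v $ 0 = 0" by simp
    with vP have "v $ i = 0" if "i \<le> m" for i using that by simp
    with v(1) have "v = 0\<^sub>v (Suc m)" by (intro eq_vecI) auto
    with v(2) show False by blast
  qed
  from det_non_zero_imp_unit[OF A this, of "()"]
  have "mat_inverse ?A \<noteq> None" using mat_inverse(1)[OF A] by metis
  then obtain B where B: "mat_inverse ?A = Some B" by blast
  from mat_inverse(2)[OF A B] have BA: "B * ?A = 1\<^sub>m (Suc m)" and Bc: "B \<in> carrier_mat (Suc m) (Suc m)" by auto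
  define M where "M = transfer_fraction a b m (of_real \<beta>) z"
  have M: "M * ?D = of_real (a (Suc m)) * ?Q (Suc m) - of_real \<beta> * ?Q m"
    unfolding M_def transfer_fraction_def using D by simp
  define x where "x = vec (Suc m) (\<lambda>k. ?Q k + M * ?P k)"
  have x: "x \<in> carrier_vec (Suc m)" by (simp add: x_def)
  have xk: "x $ k = ?Q k + M * ?P k" if "k \<le> m" for k using that by (simp add: x_def)
  have "?A *\<^sub>v x = unit_vec (Suc m) 0"
  proof (rule eq_vecI)
    fix i assume "i < dim_vec (unit_vec (Suc m) 0 :: complex vec)"
    then have i: "i \<le> m" by simp
    have "(if i = 0 then 0 else of_real (a i) * x $ (i - 1))
       = (if i = 0 then 0 else of_real (a i) * ?Q (i - 1)) + M * (if i = 0 then 0 else of_real (a i) * ?P (i - 1))"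
      using i by (simp add: xk algebra_simps)
    moreover have "(if i = m then of_real \<beta> * x $ i else of_real (a (Suc i)) * x $ Suc i)
       = of_real (a (Suc i)) * ?Q (Suc i) + M * (of_real (a (Suc i)) * ?P (Suc i))"
      using i M by (cases "i = m") (simp_all add: xk algebra_simps)
    ultimately have "(?A *\<^sub>v x) $ i = (if i = 0 then 1 else 0)"
      unfolding jacobi_perturbed_mult_vec[OF x i] xk[OF i] first_kind_recurrence[of a i b z, OF a] second_kind_recurrence[of a i b z, OF a]
      by (simp add: algebra_simps)
    then show "(?A *\<^sub>v x) $ i = unit_vec (Suc m) 0 $ i" using i by simp
  qed (use A in auto)
  then have "B *\<^sub>v unit_vec (Suc m) 0 = B *\<^sub>v (?A *\<^sub>v x)" by simp
  also have "\<dots> = x" using assoc_mult_mat_vec[OF Bc A x] BA x by simp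
  finally have "m_function a b (Suc m) \<beta> z = x \<bullet>c unit_vec (Suc m) 0"
    unfolding m_function_def B by simp
  also have "conjugate (unit_vec (Suc m) 0) = (unit_vec (Suc m) 0 :: complex vec)"
    by (rule eq_vecI) auto
  then have "x \<bullet>c unit_vec (Suc m) 0 = x $ 0" using x by simp
  also have "\<dots> = M" using xk[of 0] by simp
  finally show ?thesis by (simp only: M_def)
qed

section \<open>The averaged spectral measure\<close>

text \<open>
  Reflecting \<open>\<beta>\<close> moves the half plane of holomorphy to the upper one. There the Poisson formula at
  the point \<open>\<i>\<close>, whose kernel is \<open>1 / (1 + \<beta>\<^sup>2)\<close>, applies; boundedness holds because a Moebius
  transformation has a limit at infinity, finite here as \<open>P\<^sub>m\<close> does not vanish.
\<close>

lemma integral_transfer_fraction_cauchy_weight: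
  assumes a: "\<And>k. a (Suc k) \<noteq> 0" and z: "Im z > 0"
  shows "(\<integral>\<beta>. transfer_fraction a b m (of_real \<beta>) z / of_real (1 + \<beta>\<^sup>2) \<partial>lborel)
    = of_real pi * transfer_fraction a b m (- \<i>) z"
proof -
  define G where "G = (\<lambda>\<zeta>. transfer_fraction a b m (- \<zeta>) z)"
  let ?A = "of_real (a (Suc m)) :: complex"
  let ?P = "\<lambda>k. first_kind a b k z" and ?Q = "\<lambda>k. second_kind a b k z"
  have G: "G \<zeta> = (?A * ?Q (Suc m) + \<zeta> * ?Q m) / (- \<zeta> * ?P m - ?A * ?P (Suc m))" for \<zeta>
    by (simp add: G_def transfer_fraction_def)
  have nz: "- \<zeta> * ?P m - ?A * ?P (Suc m) \<noteq> 0" if "Im \<zeta> \<ge> 0" for \<zeta>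
    by (rule first_kind_boundary_condition_nonzero) (use a z that in auto)
  have P: "?P m \<noteq> 0" by (rule first_kind_nonzero[where a = a, OF a z])
  have cont: "continuous_on {\<zeta>. Im \<zeta> \<ge> 0} G"
    unfolding G using nz by (intro continuous_intros) blast
  have holo: "G holomorphic_on {\<zeta>. Im \<zeta> > 0}"
    unfolding G using nz by (intro holomorphic_intros) (simp add: less_imp_le)
  have "((\<lambda>\<zeta>. (?A * ?Q (Suc m) * inverse \<zeta> + ?Q m) / (- ?P m - ?A * ?P (Suc m) * inverse \<zeta>))
      \<longlongrightarrow> (?A * ?Q (Suc m) * 0 + ?Q m) / (- ?P m - ?A * ?P (Suc m) * 0)) at_infinity"
    using P by (intro tendsto_intros tendsto_inverse_0) simp
  moreover have "\<forall>\<^sub>F \<zeta> in at_infinity.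
      (?A * ?Q (Suc m) * inverse \<zeta> + ?Q m) / (- ?P m - ?A * ?P (Suc m) * inverse \<zeta>) = G \<zeta>"
    using eventually_not_equal_at_infinity[of 0]
  proof eventually_elim
    case (elim \<zeta>)
    have "N * inverse \<zeta> + q = (N + \<zeta> * q) / \<zeta>" "- q - N * inverse \<zeta> = (- \<zeta> * q - N) / \<zeta>" for N q
      using elim by (simp_all add: field_simps)
    then show ?case unfolding G using elim by (simp del: second_kind.simps)
  qed
  ultimately have "(G \<longlongrightarrow> (?A * ?Q (Suc m) * 0 + ?Q m) / (- ?P m - ?A * ?P (Suc m) * 0)) at_infinity"
    by (rule Lim_transform_eventually)
  from bounded_on_closed_if_limit_at_infinity[OF closed_upper_half_plane cont this]
  obtain C where C: "\<And>\<zeta>. Im \<zeta> \<ge> 0 \<Longrightarrow> norm (G \<zeta>) \<le> C" by (metis mem_Collect_eq)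
  have "has_bochner_integral lborel
      (\<lambda>x. G (of_real x) / ((of_real x - \<i>) * (of_real x - cnj \<i>))) (of_real (pi / Im \<i>) * G \<i>)"
    by (rule poisson_formula[OF cont holo C]) simp_all
  then have "(\<integral>x. G (of_real x) / ((of_real x - \<i>) * (of_real x - cnj \<i>)) \<partial>lborel) = of_real (pi / Im \<i>) * G \<i>"
    by (rule has_bochner_integral_integral_eq)
  then have "(\<integral>x. G (of_real x) / of_real (x\<^sup>2 + 1) \<partial>lborel) = of_real pi * G \<i>"
    unfolding mult_cnj_diff_of_real by simp
  moreover have "(\<integral>\<beta>. transfer_fraction a b m (of_real \<beta>) z / of_real (1 + \<beta>\<^sup>2) \<partial>lborel)
     = (\<integral>x. G (of_real x) / of_real (x\<^sup>2 + 1) \<partial>lborel)"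
    by (subst lborel_integral_real_affine[where c = "-1" and t = 0]) (simp_all add: G_def add.commute)
  ultimately show ?thesis by (simp add: G_def)
qed

text \<open>
  On the real line \<open>P\<^sub>k\<close> and \<open>Q\<^sub>k\<close> are real, and the numerator of the imaginary part is the Wronskian.
\<close>

lemma Im_transfer_fraction_of_real:
  assumes "\<And>k. a (Suc k) \<noteq> 0"
  shows "Im (transfer_fraction a b m (- \<i>) (of_real x))
    = 1 / ((a (Suc m))\<^sup>2 * (Re (first_kind a b (Suc m) (of_real x)))\<^sup>2 + (Re (first_kind a b m (of_real x)))\<^sup>2)"
proof -
  define P where "P k = Re (first_kind a b k (of_real x))" for k
  define Q where "Q k = Re (second_kind a b k (of_real x))" for k
  have P: "first_kind a b k (of_real x) = of_real (P k)" for k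
    by (simp add: P_def complex_eq_iff Im_first_kind_of_real)
  have Q: "second_kind a b k (of_real x) = of_real (Q k)" for k
    by (simp add: Q_def complex_eq_iff Im_second_kind_of_real)
  have "complex_of_real (a (Suc m) * (Q (Suc m) * P m - Q m * P (Suc m))) = of_real 1"
    using wronskian[of a m b "of_real x", OF assms] unfolding P Q by simp
  then have W: "a (Suc m) * (Q (Suc m) * P m - Q m * P (Suc m)) = 1"
    unfolding of_real_eq_iff .
  have "of_real s * of_real u - (- \<i>) * of_real v = Complex (s * u) v" for s u v :: real
    by (simp add: complex_eq_iff)
  moreover have "(- \<i>) * of_real v - of_real s * of_real u = Complex (- (s * u)) (- v)" for s u v :: real
    by (simp add: complex_eq_iff)
  ultimately have "transfer_fraction a b m (- \<i>) (of_real x)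
      = Complex (a (Suc m) * Q (Suc m)) (Q m) / Complex (- (a (Suc m) * P (Suc m))) (- P m)"
    unfolding transfer_fraction_def P Q by (simp only:)
  also have "Im \<dots> = (a (Suc m) * (Q (Suc m) * P m - Q m * P (Suc m))) / ((a (Suc m) * P (Suc m))\<^sup>2 + (P m)\<^sup>2)"
    by (simp add: Im_divide algebra_simps)
  finally show ?thesis unfolding W P_def[symmetric] by (simp add: power_mult_distrib)
qed

text \<open>
  The degrees of numerator and denominator are \<open>m\<close> and \<open>m + 1\<close>, so that the fraction times \<open>z + \<i>\<close> has
  a limit at infinity and is therefore bounded on the closed half plane.
\<close>

lemma transfer_fraction_stieltjes_representation:
  assumes a: "\<And>k. a (Suc k) \<noteq> 0" and z: "Im z > 0"
  shows "has_bochner_integral lborel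
     (\<lambda>x. of_real (1 / ((a (Suc m))\<^sup>2 * (Re (first_kind a b (Suc m) (of_real x)))\<^sup>2 + (Re (first_kind a b m (of_real x)))\<^sup>2))
          / (of_real x - z)) (of_real pi * transfer_fraction a b m (- \<i>) z)"
proof -
  let ?S = "{z. Im z \<ge> 0}"
  let ?A = "of_real (a (Suc m)) :: complex"
  let ?P = "first_kind a b" and ?Q = "second_kind a b"
  define F where "F = (\<lambda>z. transfer_fraction a b m (- \<i>) z)"
  have F: "F = (\<lambda>z. (?A * ?Q (Suc m) z - (- \<i>) * ?Q m z) / ((- \<i>) * ?P m z - ?A * ?P (Suc m) z))"
    by (simp add: F_def transfer_fraction_def)
  have nz: "(- \<i>) * ?P m z - ?A * ?P (Suc m) z \<noteq> 0" if "Im z \<ge> 0" for z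
    by (rule first_kind_boundary_condition_nonzero) (use a that in auto)
  have holo: "F holomorphic_on S" if "S \<subseteq> ?S" for S
    unfolding F using nz that
    by (intro holomorphic_intros holomorphic_first_kind holomorphic_second_kind) blast
  have cont: "continuous_on ?S F"
    by (rule holomorphic_on_imp_continuous_on[OF holo]) simp
  obtain c where c: "((\<lambda>z. ?Q (Suc m) z / z ^ m) \<longlongrightarrow> c) at_infinity" "((\<lambda>z. ?Q m z / z ^ m) \<longlongrightarrow> 0) at_infinity"
    using second_kind_asymptotics[of a b m, OF a] by blast
  let ?p = "\<lambda>k. complex_of_real (\<Prod>j=1..k. 1 / a j)"
  have p: "?p (Suc m) \<noteq> 0" using a
    by (metis (no_types, lifting) One_nat_def Suc_pred' atLeastAtMost_iff divide_eq_0_iff finite_atLeastAtMost less_eq_Suc_le of_real_eq_0_iff one_neq_zero prod_zero_iff)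
  have "((\<lambda>z. (?A * (?Q (Suc m) z / z ^ m) - (- \<i>) * (?Q m z / z ^ m))
        / ((- \<i>) * (?P m z / z ^ m) * inverse z - ?A * (?P (Suc m) z / z ^ Suc m)) * (1 + \<i> * inverse z))
      \<longlongrightarrow> (?A * c - (- \<i>) * 0) / ((- \<i>) * ?p m * 0 - ?A * ?p (Suc m)) * (1 + \<i> * 0)) at_infinity"
    using a p by (intro tendsto_intros c tendsto_inverse_0 first_kind_asymptotics) simp_all
  moreover have "\<forall>\<^sub>F z in at_infinity. (?A * (?Q (Suc m) z / z ^ m) - (- \<i>) * (?Q m z / z ^ m))
        / ((- \<i>) * (?P m z / z ^ m) * inverse z - ?A * (?P (Suc m) z / z ^ Suc m)) * (1 + \<i> * inverse z)
      = F z * (z + \<i>)"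
    using eventually_not_equal_at_infinity[of 0]
  proof eventually_elim
    case (elim z)
    have "?A * (?Q (Suc m) z / z ^ m) - (- \<i>) * (?Q m z / z ^ m) = (?A * ?Q (Suc m) z - (- \<i>) * ?Q m z) / z ^ m"
      by (simp add: add_divide_distrib)
    moreover have "B * (q / z ^ m) * inverse z - D * (r / z ^ Suc m) = (B * q - D * r) / (z ^ m * z)" for B D q r
      using elim by (simp add: field_simps)
    moreover have "1 + \<i> * inverse z = (z + \<i>) / z" using elim by (simp add: divide_simps)
    moreover have "(N / z ^ m) / (D / (z ^ m * z)) * (w / z) = N / D * w" for N D w :: complex
      using elim by simp
    ultimately show ?case unfolding F by (simp only:)
  qed
  ultimately have lim: "((\<lambda>z. F z * (z + \<i>)) \<longlongrightarrow> (?A * c - (- \<i>) * 0) / ((- \<i>) * ?p m * 0 - ?A * ?p (Suc m)) * (1 + \<i> * 0)) at_infinity"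
    by (rule Lim_transform_eventually)
  have "continuous_on ?S (\<lambda>z. F z * (z + \<i>))" by (intro continuous_intros cont)
  from bounded_on_closed_if_limit_at_infinity[OF closed_upper_half_plane this lim]
  obtain C where C: "\<And>z. Im z \<ge> 0 \<Longrightarrow> norm (F z * (z + \<i>)) \<le> C" by (metis mem_Collect_eq)
  have "has_bochner_integral lborel
           (\<lambda>x. of_real (Im (F (of_real x))) / (of_real x - z)) (of_real pi * F z)"
  proof (rule stieltjes_representation[OF cont holo _ z])
    show "norm (F w) * norm (w + \<i>) \<le> C" if "Im w \<ge> 0" for w
      using C[OF that] by (simp only: norm_mult)
  qed auto
  then show ?thesis
    unfolding F_def Im_transfer_fraction_of_real[where a = a, OF a] .
qed

text \<open>
  The Jacobi recurrence determines the polynomials only up to a common factor; the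
  total mass \<open>1\<close> of the measure and the positive leading coefficient fix it.
\<close>

lemma orthonormal_polys_0:
  assumes "prob_space \<rho>" "orthonormal_polys \<rho> p"
  shows "poly (p 0) x = 1"
proof -
  interpret prob_space \<rho> by fact
  have deg: "degree (p 0) = 0" and lc: "lead_coeff (p 0) > 0"
    using assms(2) unfolding orthonormal_polys_def by blast+
  have norm: "(\<integral>x. poly (p 0) x * poly (p 0) x \<partial>\<rho>) = 1"
    using assms(2) unfolding orthonormal_polys_def by simp
  obtain c where c: "p 0 = [:c:]" using deg by (rule degree_eq_zeroE)
  have "c * c = 1" using norm by (simp add: c prob_space)
  moreover have "c > 0" using lc by (simp add: c)
  ultimately have "c = 1" by (simp add: square_eq_1_iff)
  then show ?thesis by (simp add: c)
qed

lemma first_kind_eq_poly: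
  assumes p0: "poly (p 0) x = 1" and jac: "jacobi_parameters p a b"
  shows "first_kind a b k (of_real x) = of_real (poly (p k) x)"
proof -
  have a: "a (Suc k) > 0" for k using jac by (simp add: jacobi_parameters_def)
  have rec: "of_real (a (Suc k)) * complex_of_real (poly (p (Suc k)) x) = (of_real x - of_real (b (Suc k))) * of_real (poly (p k) x)
      - (if k = 0 then 0 else of_real (a k) * of_real (poly (p (k - 1)) x))" for k
  proof -
    have "x * poly (p k) x = a (Suc k) * poly (p (Suc k)) x + b (Suc k) * poly (p k) x
        + (if k = 0 then 0 else a k * poly (p (k - 1)) x)"
      using jac unfolding jacobi_parameters_def by simp
    then have "a (Suc k) * poly (p (Suc k)) x = (x - b (Suc k)) * poly (p k) x - (if k = 0 then 0 else a k * poly (p (k - 1)) x)"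
      by (simp add: algebra_simps)
    from arg_cong[OF this, of complex_of_real] show ?thesis by (cases k) simp_all
  qed
  show ?thesis
  proof (induction k rule: less_induct)
    case (less k)
    show ?case
    proof (cases k)
      case 0
      then show ?thesis by (simp add: p0)
    next
      case (Suc j)
      have "of_real (a (Suc j)) * first_kind a b (Suc j) (of_real x) = of_real (a (Suc j)) * complex_of_real (poly (p (Suc j)) x)"
        unfolding rec by (subst first_kind_recurrence) (use a[of j] less Suc in \<open>auto simp: less_imp_neq[symmetric]\<close>)
      then show ?thesis using a[of j] Suc by simp
    qed
  qed
qed

theorem theorem2p1:
  fixes \<rho> \<nu> :: "real measure" and p :: "nat \<Rightarrow> real poly" and a b :: "nat \<Rightarrow> real" and n :: nat
  assumes "prob_space \<rho>" and "sets \<rho> = sets borel"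
    and "bounded (measure_support \<rho>)" and "infinite (measure_support \<rho>)"
    and "orthonormal_polys \<rho> p"
    and "jacobi_parameters p a b"
    and "n \<ge> 1"
  shows "averaged_spectral_measure a b n \<nu> \<longleftrightarrow>
    \<nu> = density lborel
          (\<lambda>x. ennreal (1 / (pi * ((a n)\<^sup>2 * (poly (p n) x)\<^sup>2 + (poly (p (n - 1)) x)\<^sup>2))))"
proof -
  obtain m where n: "n = Suc m" using \<open>n \<ge> 1\<close> by (cases n) auto
  have a: "a (Suc k) \<noteq> 0" for k
    using assms(6) unfolding jacobi_parameters_def by (metis Suc_le_mono le0 One_nat_def less_irrefl)
  define d where "d x = 1 / ((a n)\<^sup>2 * (poly (p n) x)\<^sup>2 + (poly (p (n - 1)) x)\<^sup>2)" for x
  define \<mu> where "\<mu> = density lborel (\<lambda>x. ennreal (d x / pi))"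
  have d_nonneg: "d x \<ge> 0" for x unfolding d_def by simp
  have [measurable]: "poly q \<in> borel_measurable borel" for q :: "real poly"
    by (intro borel_measurable_continuous_onI continuous_on_poly continuous_on_id)
  have d_meas [measurable]: "d \<in> borel_measurable borel" unfolding d_def by measurable
  let ?F = "\<lambda>z. transfer_fraction a b m (- \<i>) z"
  have average: "complex_of_real (1 / pi) * (\<integral>\<beta>. m_function a b n \<beta> z / complex_of_real (1 + \<beta>\<^sup>2) \<partial>lborel) = ?F z"
    if "Im z > 0" for z
    unfolding n m_function_eq_transfer_fraction[where a = a, OF a that]
      integral_transfer_fraction_cauchy_weight[where a = a, OF a that]
    by simp
  have \<mu>: "has_bochner_integral \<mu> (\<lambda>x. 1 / (complex_of_real x - z)) (?F z)" if z: "Im z > 0" for z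
  proof -
    have P: "Re (first_kind a b k (of_real x)) = poly (p k) x" for k x
      using first_kind_eq_poly[OF orthonormal_polys_0[OF assms(1,5)] assms(6)] by simp
    have "has_bochner_integral lborel (\<lambda>x. of_real (d x) / (of_real x - z)) (of_real pi * ?F z)"
      using transfer_fraction_stieltjes_representation[where a = a and b = b and m = m, OF a z] unfolding P d_def n diff_Suc_1 .
    then have "has_bochner_integral lborel (\<lambda>x. of_real (1 / pi) * (of_real (d x) / (of_real x - z))) (of_real (1 / pi) * (of_real pi * ?F z))"
      by (rule has_bochner_integral_mult_right)
    moreover have "of_real (1 / pi) * (of_real (d x) / (of_real x - z)) = (d x / pi) *\<^sub>R (1 / (complex_of_real x - z))" for x
      by (simp add: scaleR_conv_of_real)
    moreover have "complex_of_real (1 / pi) * (of_real pi * ?F z) = ?F z" by simp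
    ultimately have "has_bochner_integral lborel (\<lambda>x. (d x / pi) *\<^sub>R (1 / (complex_of_real x - z))) (?F z)"
      by (simp only:)
    then show ?thesis
      unfolding \<mu>_def by (rule has_bochner_integral_density[rotated -1]) (auto simp: d_nonneg)
  qed
  have \<mu>_transformable: "stieltjes_transformable \<mu>"
    using \<mu> by unfold_locales (auto simp: \<mu>_def has_bochner_integral_iff)
  have "averaged_spectral_measure a b n \<nu> \<longleftrightarrow> \<nu> = \<mu>"
  proof
    assume \<nu>: "averaged_spectral_measure a b n \<nu>"
    show "\<nu> = \<mu>"
    proof (rule stieltjes_transform_unique[OF _ \<mu>_transformable])
      show "stieltjes_transformable \<nu>"
        using \<nu> by unfold_locales (auto simp: averaged_spectral_measure_def)
      show "(\<integral>x. 1 / (complex_of_real x - z) \<partial>\<nu>) = (\<integral>x. 1 / (complex_of_real x - z) \<partial>\<mu>)" if "Im z > 0" for z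
        using \<nu> that average[OF that] has_bochner_integral_integral_eq[OF \<mu>[OF that]]
        unfolding averaged_spectral_measure_def by metis
    qed
  next
    assume "\<nu> = \<mu>"
    then show "averaged_spectral_measure a b n \<nu>"
      unfolding averaged_spectral_measure_def
      using average \<mu> by (auto simp: has_bochner_integral_iff \<mu>_def)
  qed
  then show ?thesis by (simp add: \<mu>_def d_def mult.commute)
qed

end
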